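(* Let $\mathbf{X}_{[1,\infty)}=\{X_n:n\ge1\}$ be a non-deterministic infinite sequence of exchangeable $\{0,1\}$-valued random variables. For $\mathbf{X}_{[1,\infty)}$ to be Hoeffding decomposable, it is necessary and sufficient that, for every $n\ge 2$, every $u=2,\dots,n$ and every $z=0,\dots,n-1$, $$0=\sum_{k=0\vee(z-(u-1))}^{z\wedge(n-u)}(-1)^k\binom{n-u}{k}\sum_{m=0}^{u}(-1)^m\binom{u}{m}\,\mathbb P_{n+u-1}^{n}\left(0^{(m+z)}\mid 0^{(m+k)}\right).$$
   Context: Let $\mathbf{X}_{[1,\infty)}=\{X_n:n\ge 1\}$ be an infinite exchangeable sequence of $\{0,1\}$-valued random variables on a probability space $(\Omega,\mathcal F,\mathbb P)$ with $\mathcal F=\sigma(\mathbf{X}_{[1,\infty)})$. By de Finetti's theorem there is a unique probability measure $\gamma$ on $[0,1]$ such that $\mathbb P\{X_1=j_1,\dots,X_n=j_n\}=\int_{[0,1]}\theta^{\sum_k j_k}(1-\theta)^{n-\sum_k j_k}\,\gamma(\mathrm d\theta)$ for all $n\ge1$ and $(j_1,\dots,j_n)\in\{0,1\}^n$. The sequence is called non-deterministic if the support of $\gamma$ is not contained in $\{0\}\cup\{1\}$. Notation: $\mathbf{X}_{[n]}=(X_1,\dots,X_n)$, $\mathbf{X}_{[2,k]}=(X_2,\dots,X_k)$ (for $k=1$ conditioning on $\mathbf{X}_{[2,k]}$ means taking the plain expectation), $a\vee b=\max\{a,b\}$, $a\wedge b=\min\{a,b\}$. For $n\ge 1$, $v\ge1$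 and $0\le a\le b$, $\mathbb P_{n+v}^{n}(0^{(b)}\mid 0^{(a)})$ denotes the conditional probability that the vector $\mathbf{X}_{[n+v]}$ contains exactly $b$ zeros, given that the subvector $\mathbf{X}_{[n]}$ contains exactly $a$ zeros; equivalently, the probability that $(X_{n+1},\dots,X_{n+v})$ contains exactly $b-a$ zeros given that $\mathbf{X}_{[n]}$ contains exactly $a$ zeros. Hoeffding decomposability: for $n\ge 2$, let $L_s(\mathbf{X}_{[n]})$ be the Hilbert space of random variables $T(X_1,\dots,X_n)$ with $T:\{0,1\}^n\to\mathbb R$ symmetric, with inner product $\langle T_1,T_2\rangle=\mathbb E[T_1(\mathbf{X}_{[n]})T_2(\mathbf{X}_{[n]})]$. Set $SU_0(\mathbf{X}_{[n]})=\mathbb R$ and, for $k=1,\dots,n$, let $SU_k(\mathbf{X}_{[n]})$ be the space of all random variables of the form $$F(\mathbf{X}_{[n]})=\sum_{1\le j_1<\dots<j_k\le n}\varphi(X_{j_1},\dots,X_{j_k}),\qquad \varphi:\{0,1\}^k\to\mathbb R \text{ symmetric}$$ (the kernel $\varphi$ is unique in the sense that two symmetric kernels representing the same $F$ agree a.s. when evaluated at $\mathbf{X}_{[k]}$). For $k=1,\dots,n$ let $SH_k(\mathbf{X}_{[n]})=SU_k(\mathbf{X}_{[n]})\cap SU_{k-1}(\mathbf{X}_{[n]})^{\perp}$, the orthogonal being taken in $L_s(\mathbf{X}_{[n]})$. The sequence $\mathbf{X}_{[1,\infty)}$ is Hoeffding decomposable if for every $n\ge2$ and every $k=1,\dots,n$: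 a random variable $F=\sum_{1\le j_1<\dots<j_k\le n}\varphi(X_{j_1},\dots,X_{j_k})\in SU_k(\mathbf{X}_{[n]})$, with symmetric kernel $\varphi:\{0,1\}^k\to\mathbb R$, belongs to $SH_k(\mathbf{X}_{[n]})$ if, and only if, $\mathbb E[\varphi(\mathbf{X}_{[k]})\mid \mathbf{X}_{[2,k]}]=0$ a.s.-$\mathbb P$. *)

theory Defs
  imports "HOL-Probability.Probability" "HOL-Combinatorics.Permutations"
begin

text \<open>
  A sequence is a function \<open>X :: nat \<Rightarrow> 'a \<Rightarrow> nat\<close> of which only the values \<open>X n\<close> with \<open>n \<ge> 1\<close>
  matter. Vectors in \<open>{0,1}\<^sup>k\<close> are lists of length \<open>k\<close> with entries in \<open>{0,1}\<close>; kernels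
  \<open>{0,1}\<^sup>k \<rightarrow> \<real>\<close> are functions on lists whose values off \<open>binary_vectors k\<close> are irrelevant.
\<close>

definition binary_vectors :: "nat \<Rightarrow> nat list set" where
  "binary_vectors k = {xs. length xs = k \<and> set xs \<subseteq> {0, 1}}"

text \<open>\<open>subvector X J\<close> is the vector of the \<open>X j\<close> with \<open>j \<in> J\<close>, in increasing order of \<open>j\<close>. It is
  the empty list if \<open>J = {}\<close>.\<close>

definition subvector :: "(nat \<Rightarrow> 'a \<Rightarrow> nat) \<Rightarrow> nat set \<Rightarrow> 'a \<Rightarrow> nat list" where
  "subvector X J \<omega> = map (\<lambda>j. X j \<omega>) (sorted_list_of_set J)"

lemma measurable_subvector:
  assumes "\<And>n. n \<ge> 1 \<Longrightarrow> X n \<in> M \<rightarrow>\<^sub>M count_space {0, 1}" and J: "finite J" "0 \<notin> J"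
  shows "subvector X J \<in> M \<rightarrow>\<^sub>M count_space UNIV"
proof -
  have "(\<lambda>\<omega>. map (\<lambda>j. X j \<omega>) js) \<in> M \<rightarrow>\<^sub>M count_space UNIV" if "0 \<notin> set js" for js
    using that
  proof (induction js)
    case (Cons j js)
    have "X j \<in> M \<rightarrow>\<^sub>M count_space {0, 1}"
      using Cons.prems by (intro assms(1)) (simp add: Suc_le_eq)
    then have j: "X j \<in> M \<rightarrow>\<^sub>M count_space UNIV"
      by (rule measurable_compose[where g = "\<lambda>x. x", OF _ measurable_count_space])
    have js: "(\<lambda>\<omega>. map (\<lambda>j. X j \<omega>) js) \<in> M \<rightarrow>\<^sub>M count_space UNIV"
      using Cons by simp
    have "count_space UNIV \<Otimes>\<^sub>M count_space UNIV = (count_space UNIV :: (nat \<times> nat list) measure)"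
      using pair_measure_countable[of "UNIV :: nat set" "UNIV :: nat list set"] by simp
    with measurable_Pair[OF j js]
    have "(\<lambda>\<omega>. (X j \<omega>, map (\<lambda>j. X j \<omega>) js)) \<in> M \<rightarrow>\<^sub>M count_space UNIV"
      by simp
    from measurable_compose[OF this measurable_count_space[of "\<lambda>(x, xs). x # xs"]]
    show ?case by simp
  qed simp
  from this[of "sorted_list_of_set J"] J show ?thesis
    by (simp add: subvector_def[abs_def])
qed

definition exchangeable :: "'a measure \<Rightarrow> (nat \<Rightarrow> 'a \<Rightarrow> nat) \<Rightarrow> bool" where
  "exchangeable M X \<longleftrightarrow>
     (\<forall>n \<pi>. \<pi> permutes {1..n} \<longrightarrow>
        distr M (count_space UNIV) (subvector (\<lambda>i. X (\<pi> i)) {1..n}) =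
        distr M (count_space UNIV) (subvector X {1..n}))"

definition de_finetti_measure :: "'a measure \<Rightarrow> (nat \<Rightarrow> 'a \<Rightarrow> nat) \<Rightarrow> real measure \<Rightarrow> bool" where
  "de_finetti_measure M X \<gamma> \<longleftrightarrow>
     prob_space \<gamma> \<and> sets \<gamma> = sets (restrict_space borel {0..1}) \<and>
     (\<forall>n\<ge>1. \<forall>js\<in>binary_vectors n.
        \<P>(\<omega> in M. subvector X {1..n} \<omega> = js) =
        (\<integral>\<theta>. \<theta> ^ sum_list js * (1 - \<theta>) ^ (n - sum_list js) \<partial>\<gamma>))"

definition measure_support :: "real measure \<Rightarrow> real set" where
  "measure_support \<gamma> = {x \<in> space \<gamma>. \<forall>U. open U \<and> x \<in> U \<longrightarrow> measure \<gamma> (U \<inter> space \<gamma>) > 0}"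

text \<open>By de Finetti's theorem the mixing measure of an infinite exchangeable sequence exists and
  is unique, so \<open>\<exists>\<close> expresses a property of the mixing measure.\<close>

definition non_deterministic :: "'a measure \<Rightarrow> (nat \<Rightarrow> 'a \<Rightarrow> nat) \<Rightarrow> bool" where
  "non_deterministic M X \<longleftrightarrow>
     (\<exists>\<gamma>. de_finetti_measure M X \<gamma> \<and> \<not> measure_support \<gamma> \<subseteq> {0} \<union> {1})"

definition symmetric_kernel :: "nat \<Rightarrow> (nat list \<Rightarrow> real) \<Rightarrow> bool" where
  "symmetric_kernel k \<phi> \<longleftrightarrow>
     (\<forall>\<pi>. \<pi> permutes {..<k} \<longrightarrow> (\<forall>xs\<in>binary_vectors k. \<phi> (permute_list \<pi> xs) = \<phi> xs))"

text \<open>The spaces below consist of functions on the sample space rather than of classes modulo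
  almost sure equality; orthogonality depends only on these classes.\<close>

definition Ls :: "(nat \<Rightarrow> 'a \<Rightarrow> nat) \<Rightarrow> nat \<Rightarrow> ('a \<Rightarrow> real) set" where
  "Ls X n = {\<lambda>\<omega>. T (subvector X {1..n} \<omega>) | T. symmetric_kernel n T}"

definition orth_Ls ::
  "'a measure \<Rightarrow> (nat \<Rightarrow> 'a \<Rightarrow> nat) \<Rightarrow> nat \<Rightarrow> ('a \<Rightarrow> real) set \<Rightarrow> ('a \<Rightarrow> real) set" where
  "orth_Ls M X n S = {F \<in> Ls X n. \<forall>G\<in>S. (\<integral>\<omega>. F \<omega> * G \<omega> \<partial>M) = 0}"

definition U_statistic ::
  "(nat \<Rightarrow> 'a \<Rightarrow> nat) \<Rightarrow> nat \<Rightarrow> nat \<Rightarrow> (nat list \<Rightarrow> real) \<Rightarrow> 'a \<Rightarrow> real" where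
  "U_statistic X n k \<phi> \<omega> = (\<Sum>J | J \<subseteq> {1..n} \<and> card J = k. \<phi> (subvector X J \<omega>))"

definition SU :: "(nat \<Rightarrow> 'a \<Rightarrow> nat) \<Rightarrow> nat \<Rightarrow> nat \<Rightarrow> ('a \<Rightarrow> real) set" where
  "SU X n k = {U_statistic X n k \<phi> | \<phi>. symmetric_kernel k \<phi>}"

text \<open>For \<open>k = 0\<close> the definition yields the constants.\<close>

lemma SU_0:
  fixes X :: "nat \<Rightarrow> 'a \<Rightarrow> nat"
  shows "SU X n 0 = range (\<lambda>c _. c)"
proof -
  have 1: "{J. J \<subseteq> {1..n} \<and> card J = 0} = {{}}"
    using finite_subset[of _ "{1..n}"] by (auto simp: card_eq_0_iff)
  have 2: "U_statistic X n 0 \<phi> = (\<lambda>_. \<phi> [])" for \<phi>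
    unfolding U_statistic_def 1 by (simp add: subvector_def fun_eq_iff)
  show ?thesis
  proof (intro equalityI subsetI)
    fix F assume "F \<in> range (\<lambda>c (_ :: 'a). c :: real)"
    then obtain c where "F = (\<lambda>_. c)" by auto
    then have "F = U_statistic X n 0 (\<lambda>_. c)" by (simp add: 2)
    moreover have "symmetric_kernel 0 (\<lambda>_. c)"
      by (simp add: symmetric_kernel_def)
    ultimately show "F \<in> SU X n 0" unfolding SU_def by blast
  qed (auto simp: SU_def 2)
qed

definition SH :: "'a measure \<Rightarrow> (nat \<Rightarrow> 'a \<Rightarrow> nat) \<Rightarrow> nat \<Rightarrow> nat \<Rightarrow> ('a \<Rightarrow> real) set" where
  "SH M X n k = SU X n k \<inter> orth_Ls M X n (SU X n (k - 1))"

definition sigma_of_vector :: "'a measure \<Rightarrow> (nat \<Rightarrow> 'a \<Rightarrow> nat) \<Rightarrow> nat set \<Rightarrow> 'a measure" where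
  "sigma_of_vector M X J = vimage_algebra (space M) (subvector X J) (count_space UNIV)"

text \<open>For \<open>k = 1\<close> the conditioning algebra \<open>sigma_of_vector M X {2..1}\<close> is trivial, so that the
  conditional expectation is the plain expectation.\<close>

definition Hoeffding_decomposable :: "'a measure \<Rightarrow> (nat \<Rightarrow> 'a \<Rightarrow> nat) \<Rightarrow> bool" where
  "Hoeffding_decomposable M X \<longleftrightarrow>
     (\<forall>n\<ge>2. \<forall>k\<in>{1..n}. \<forall>\<phi>. symmetric_kernel k \<phi> \<longrightarrow>
        (U_statistic X n k \<phi> \<in> SH M X n k \<longleftrightarrow>
         (AE \<omega> in M. real_cond_exp M (sigma_of_vector M X {2..k})
                        (\<lambda>\<omega>. \<phi> (subvector X {1..k} \<omega>)) \<omega> = 0)))"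

text \<open>\<open>zeros_cond_prob M X N n b a\<close> is the conditional probability of exactly \<open>b\<close> zeros among
  \<open>X 1, \<dots>, X N\<close> given exactly \<open>a\<close> zeros among \<open>X 1, \<dots>, X n\<close>.\<close>

definition zeros_cond_prob ::
  "'a measure \<Rightarrow> (nat \<Rightarrow> 'a \<Rightarrow> nat) \<Rightarrow> nat \<Rightarrow> nat \<Rightarrow> nat \<Rightarrow> nat \<Rightarrow> real" where
  "zeros_cond_prob M X N n b a =
     \<P>(\<omega> in M. count_list (subvector X {1..N} \<omega>) 0 = b \<bar> count_list (subvector X {1..n} \<omega>) 0 = a)"

end

theory Submission
  imports Defs
begin

text \<open>
  Let \<open>f a b\<close> be the probability of a configuration with \<open>a\<close> zeros and \<open>b\<close> ones; it is positive
  because the mixing measure charges the open unit interval. A symmetric kernel \<open>\<phi>\<close> of \<open>k\<close>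
  variables has vanishing conditional expectation given \<open>k - 1\<close> of them iff it is a multiple of the
  degenerate kernel \<open>a \<mapsto> (-1)\<^sup>a / f a (k - a)\<close>, where \<open>a\<close> is the number of zeros. As
  \<open>SU\<^sub>k\<^sub>-\<^sub>1\<close> has codimension one in \<open>SU\<^sub>k\<close>, decomposability means that for all \<open>k \<le> n\<close> the
  U-statistic of the degenerate kernel is orthogonal to \<open>SU\<^sub>k\<^sub>-\<^sub>1\<close>. The inner product is a
  sum over pairs \<open>J\<close>, \<open>L\<close> of index sets of sizes \<open>k\<close> and \<open>k - 1\<close>, and each summand depends only
  on \<open>u = card (J - L)\<close>. Letting \<open>n = k, k + 1, \<dots>\<close> separates the values of \<open>u\<close>: the
  summand has to vanish for each \<open>u\<close>. It does so automatically for \<open>u = 1\<close>, and for \<open>u \<ge> 2\<close> it is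
  the alternating sum of conditional probabilities, with \<open>k\<close> in the role of \<open>n\<close> and \<open>z\<close> the
  number of zeros in \<open>L\<close>.
\<close>

subsection \<open>Sums over subsets\<close>

lemma sum_Pow_card:
  fixes g :: "nat \<Rightarrow> real"
  assumes "finite A"
  shows "(\<Sum>S\<in>Pow A. g (card S)) = (\<Sum>a\<le>card A. real (card A choose a) * g a)"
proof -
  have "(\<Sum>S\<in>Pow A. g (card S)) = (\<Sum>a\<le>card A. \<Sum>S | S \<in> Pow A \<and> card S = a. g (card S))"
    using assms by (intro sum.group[symmetric]) (auto intro: card_mono)
  also have "\<dots> = (\<Sum>a\<le>card A. real (card A choose a) * g a)"
    using assms by (intro sum.cong refl) (simp add: n_subsets)
  finally show ?thesis .
qed

lemma sum_Pow_card3: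
  fixes g :: "nat \<Rightarrow> nat \<Rightarrow> nat \<Rightarrow> real"
  assumes "finite A" "finite B" "finite C"
  shows "(\<Sum>S\<in>Pow A. \<Sum>T\<in>Pow B. \<Sum>U\<in>Pow C. g (card S) (card T) (card U)) =
    (\<Sum>a\<le>card A. real (card A choose a) * (\<Sum>b\<le>card B. real (card B choose b) *
      (\<Sum>c\<le>card C. real (card C choose c) * g a b c)))"
  unfolding sum_Pow_card[OF assms(3)]
  unfolding sum_Pow_card[OF assms(2), where g = "\<lambda>b. \<Sum>c\<le>card C. real (card C choose c) * g _ b c"]
  by (rule sum_Pow_card[OF assms(1)])

lemma sum_Pow_Un:
  assumes "finite A" "finite B" "A \<inter> B = {}"
  shows "(\<Sum>S\<in>Pow (A \<union> B). g S) = (\<Sum>S\<in>Pow A. \<Sum>T\<in>Pow B. g (S \<union> T))"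
proof -
  have "(\<Sum>S\<in>Pow (A \<union> B). g S) = (\<Sum>(S, T)\<in>Pow A \<times> Pow B. g (S \<union> T))"
    by (rule sum.reindex_bij_witness[where j = "\<lambda>S. (S \<inter> A, S \<inter> B)" and i = "\<lambda>(S, T). S \<union> T"])
       (use assms in \<open>auto intro: arg_cong[of _ _ g]\<close>)
  then show ?thesis by (simp add: sum.cartesian_product)
qed

lemma sum_Pow_insert:
  assumes "finite A" "x \<notin> A"
  shows "(\<Sum>S\<in>Pow (insert x A). g S) = (\<Sum>S\<in>Pow A. g S + g (insert x S))"
  using sum_Pow_Un[of A "{x}" g] assms by (simp add: Pow_insert add.commute)

text \<open>Choosing \<open>J\<close> means choosing \<open>J \<inter> S\<close> inside
  \<open>S\<close> and \<open>J - S\<close> inside \<open>U - S\<close>, which gives the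
  hypergeometric count. With \<open>S\<close> the set of zeros, a U-statistic becomes a function of
  the number of zeros.\<close>

lemma sum_subsets_card_Int:
  fixes g :: "nat \<Rightarrow> real"
  assumes "finite U" "S \<subseteq> U"
  shows "(\<Sum>J | J \<subseteq> U \<and> card J = k. g (card (J \<inter> S))) =
    (\<Sum>a\<le>k. real ((card S choose a) * ((card U - card S) choose (k - a))) * g a)"
proof -
  have fin: "finite S" "finite (U - S)" using assms finite_subset by auto
  have "(\<Sum>J | J \<subseteq> U \<and> card J = k. g (card (J \<inter> S))) =
      (\<Sum>J\<in>Pow U. if card J = k then g (card (J \<inter> S)) else 0)"
    by (rule sum.mono_neutral_cong_left) (use assms in auto)
  also have "\<dots> = (\<Sum>J\<in>Pow (S \<union> (U - S)). if card J = k then g (card (J \<inter> S)) else 0)"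
    using assms by (simp add: Un_absorb1)
  also have "\<dots> = (\<Sum>A\<in>Pow S. \<Sum>B\<in>Pow (U - S). if card A + card B = k then g (card A) else 0)"
  proof (subst sum_Pow_Un, goal_cases)
    case 4
    have "card (A \<union> B) = card A + card B" "(A \<union> B) \<inter> S = A" if "A \<in> Pow S" "B \<in> Pow (U - S)" for A B
      using that fin by (auto intro!: card_Un_disjoint intro: finite_subset)
    then show ?case by (intro sum.cong refl) simp
  qed (use fin in auto)
  also have "\<dots> = (\<Sum>A\<in>Pow S. \<Sum>b\<le>card (U - S). real (card (U - S) choose b) * (if card A + b = k then g (card A) else 0))"
    using fin by (intro sum.cong refl)
      (subst sum_Pow_card[where g = "\<lambda>b. if _ + b = k then _ else 0"], auto)
  also have "\<dots> = (\<Sum>a\<le>card S. real (card S choose a) *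
      (\<Sum>b\<le>card (U - S). real (card (U - S) choose b) * (if a + b = k then g a else 0)))"
    using fin(1) by (rule sum_Pow_card)
  also have "\<dots> = (\<Sum>a\<le>card S. if a \<le> k then real (card S choose a) * (real (card (U - S) choose (k - a)) * g a) else 0)"
  proof (intro sum.cong refl, goal_cases)
    case (1 a)
    have "(\<Sum>b\<le>card (U - S). real (card (U - S) choose b) * (if a + b = k then g a else 0)) =
      (if a \<le> k then real (card (U - S) choose (k - a)) * g a else 0)"
    proof (cases "a \<le> k")
      case True
      have "(\<Sum>b\<le>card (U - S). real (card (U - S) choose b) * (if a + b = k then g a else 0)) =
        (\<Sum>b\<le>card (U - S). if b = k - a then real (card (U - S) choose b) * g a else 0)"
        using True by (intro sum.cong refl) auto
      then show ?thesis using True by (simp add: sum.delta binomial_eq_0)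
    qed (auto intro: sum.neutral)
    then show ?case by simp
  qed
  also have "\<dots> = (\<Sum>a\<in>{..card S} \<inter> {..k}. real (card S choose a) * (real (card (U - S) choose (k - a)) * g a))"
    by (subst sum.inter_restrict) auto
  also have "\<dots> = (\<Sum>a\<le>k. real (card S choose a) * (real (card (U - S) choose (k - a)) * g a))"
    by (rule sum.mono_neutral_left) (auto simp: binomial_eq_0)
  finally show ?thesis using fin assms by (simp add: card_Diff_subset mult.assoc)
qed

lemma card_Diff_bounds:
  assumes "finite L" "finite J" "card J = k" "card L = k - 1" "1 \<le> k"
  shows "1 \<le> card (J - L)" "card (J - L) \<le> k"
  using assms diff_card_le_card_Diff[of L J] card_mono[of J "J - L"] by auto

text \<open>Double counting of the pairs \<open>(J, j)\<close>: a set \<open>L\<close> arises as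
  \<open>J - {j}\<close> once for each of the \<open>card U - (k - 1)\<close> elements
  \<open>j\<close> outside \<open>L\<close>.\<close>

lemma sum_subsets_remove:
  fixes g :: "'b set \<Rightarrow> real"
  assumes "finite U" "k \<ge> 1"
  shows "(\<Sum>J | J \<subseteq> U \<and> card J = k. \<Sum>j\<in>J. g (J - {j})) =
    real (card U + 1 - k) * (\<Sum>L | L \<subseteq> U \<and> card L = k - 1. g L)"
proof -
  have fin: "finite J" if "J \<subseteq> U" for J using that assms finite_subset by auto
  have "(\<Sum>J | J \<subseteq> U \<and> card J = k. \<Sum>j\<in>J. g (J - {j})) =
      (\<Sum>(J, j)\<in>Sigma {J. J \<subseteq> U \<and> card J = k} (\<lambda>J. J). g (J - {j}))"
    using assms fin by (intro sum.Sigma) auto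
  also have "\<dots> = (\<Sum>(L, j)\<in>Sigma {L. L \<subseteq> U \<and> card L = k - 1} (\<lambda>L. U - L). g L)"
    by (rule sum.reindex_bij_witness[where j = "\<lambda>(J, j). (J - {j}, j)" and i = "\<lambda>(L, j). (insert j L, j)"])
       (use assms fin in \<open>auto simp: card_insert_if\<close>)
  also have "\<dots> = (\<Sum>L | L \<subseteq> U \<and> card L = k - 1. \<Sum>j\<in>U - L. g L)"
    using assms by (intro sum.Sigma[symmetric]) auto
  also have "\<dots> = (\<Sum>L | L \<subseteq> U \<and> card L = k - 1. real (card U + 1 - k) * g L)"
    using assms fin by (intro sum.cong refl) (auto simp: card_Diff_subset)
  finally show ?thesis by (simp add: sum_distrib_left)
qed

text \<open>The system is triangular: for \<open>card S = a\<close> only intersection sizes up to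
  \<open>a\<close> occur, the smaller ones vanish by induction, and the coefficient of
  \<open>g a\<close> is \<open>(card U - a) choose (k - a)\<close>, which is positive since
  \<open>k \<le> card U\<close>. Thus a U-statistic determines its kernel.\<close>

lemma sum_subsets_card_Int_inject:
  fixes g :: "nat \<Rightarrow> real"
  assumes "finite U" "k \<le> card U" "a \<le> k"
    and zero: "\<And>S. S \<subseteq> U \<Longrightarrow> (\<Sum>J | J \<subseteq> U \<and> card J = k. g (card (J \<inter> S))) = 0"
  shows "g a = 0"
  using assms(3)
proof (induction a rule: less_induct)
  case (less a)
  obtain S where S: "S \<subseteq> U" "card S = a"
    using obtain_subset_with_card_n[of a U] less.prems assms(2) by auto
  have "0 = (\<Sum>j\<le>k. real ((a choose j) * ((card U - a) choose (k - j))) * g j)"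
    using sum_subsets_card_Int[OF assms(1) S(1), of g k] zero[OF S(1)] S(2) by simp
  also have "\<dots> = (\<Sum>j\<in>{a}. real ((a choose j) * ((card U - a) choose (k - j))) * g j)"
    using less by (intro sum.mono_neutral_right) (auto simp: binomial_eq_0 not_le neq_iff)
  finally show "g a = 0"
    using less.prems diff_le_mono[OF assms(2), of a] assms(2) by (auto simp: not_less)
qed

text \<open>The alternating binomial sum annihilates exactly the kernels obtained by summing a kernel
  of one variable less over the subvectors.\<close>

lemma solve_lift:
  fixes g :: "nat \<Rightarrow> real"
  assumes "k \<ge> 1" and zero: "(\<Sum>a\<le>k. (- 1) ^ a * real (k choose a) * g a) = 0"
  obtains h where "\<And>a. a \<le> k \<Longrightarrow> g a = real (k - a) * h a + real a * h (a - 1)"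
proof -
  \<comment> \<open>Put \<open>t a = (- 1) ^ a * k * ((k - 1) choose a) * h a\<close>. Multiplying
    the wanted equation by \<open>(- 1) ^ a * (k choose a)\<close> turns it into
    \<open>s a - s (a - 1) = t a - t (a - 1)\<close> for \<open>a > 0\<close>, and solving
    \<open>t = s\<close> for \<open>h\<close> gives the formula below.\<close>
  define s where "s a = (\<Sum>j\<le>a. (- 1) ^ j * real (k choose j) * g j)" for a
  define h where "h a = (- 1) ^ a * s a / (real k * real ((k - 1) choose a))" for a
  have "g a = real (k - a) * h a + real a * h (a - 1)" if a: "a \<le> k" for a
  proof -
    have 1: "real (k - a) * h a = (- 1) ^ a * s a / real (k choose a)"
    proof (cases "a = k")
      \<comment> \<open>At \<open>a = k\<close> the left side has the factor \<open>k - k\<close>;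
        the right side vanishes because the hypothesis says \<open>s k = 0\<close>.\<close>
      case True
      then show ?thesis using zero by (simp add: s_def)
    next
      case False
      have eq: "real (k - a) * real (k choose a) = real k * real ((k - 1) choose a)"
        using binomial_absorb_comp[of k a] by (simp flip: of_nat_mult)
      moreover have "real (k choose a) \<noteq> 0" "real (k - a) \<noteq> 0" using False a by auto
      ultimately show ?thesis unfolding h_def eq[symmetric] by (simp del: of_nat_diff)
    qed
    show ?thesis
    proof (cases a)
      case 0
      then show ?thesis using 1 by (simp add: s_def)
    next
      case (Suc b)
      have eq: "real a * real (k choose a) = real k * real ((k - 1) choose b)"
        using binomial_absorption[of b k] Suc by (metis of_nat_mult)
      have nz: "real (k choose a) \<noteq> 0" "real a \<noteq> 0" using Suc a by auto
      have h: "h (a - 1) = (- 1) ^ b * s b / (real a * real (k choose a))"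
        unfolding h_def eq by (simp add: Suc)
      have 2: "real a * h (a - 1) = (- 1) ^ b * s b / real (k choose a)"
        unfolding h using nz by simp
      have s: "s a = s b + (- 1) ^ a * (real (k choose a) * g a)"
        by (simp add: s_def Suc)
      have "(- 1) ^ a * s a + (- 1) ^ b * s b =
          ((- 1) ^ a + (- 1) ^ b) * s b + ((- 1) ^ a * (- 1) ^ a) * (real (k choose a) * g a)"
        unfolding s by (simp only: algebra_simps)
      also have "\<dots> = real (k choose a) * g a"
        by (simp add: Suc flip: power_mult_distrib)
      finally show ?thesis unfolding 1 2 using nz by (simp flip: add_divide_distrib)
    qed
  qed
  then show ?thesis by (rule that)
qed

subsection \<open>Symmetric kernels and U-statistics\<close>

text \<open>A symmetric kernel depends only on the number \<open>a\<close> of zeros; its value is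
  read off at the vector with all zeros in front. Only \<open>a \<le> k\<close> is
  meaningful.\<close>

definition profile :: "nat \<Rightarrow> (nat list \<Rightarrow> real) \<Rightarrow> nat \<Rightarrow> real" where
  "profile k \<phi> a = \<phi> (replicate a 0 @ replicate (k - a) 1)"

text \<open>Recording an outcome by the positions of its zeros turns expectations into finite sums
  over subsets.\<close>

definition zero_set :: "(nat \<Rightarrow> 'a \<Rightarrow> nat) \<Rightarrow> nat set \<Rightarrow> 'a \<Rightarrow> nat set" where
  "zero_set X J \<omega> = {i \<in> J. X i \<omega> = 0}"

lemma zero_set_subset: "J \<subseteq> K \<Longrightarrow> zero_set X J \<omega> = J \<inter> zero_set X K \<omega>"
  by (auto simp: zero_set_def)

lemma mset_binary_vector:
  assumes "xs \<in> binary_vectors k"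
  shows "mset xs = mset (replicate (count_list xs 0) 0 @ replicate (k - count_list xs 0) 1)"
proof -
  have "count_list xs 0 \<le> length xs \<and>
      mset xs = mset (replicate (count_list xs 0) 0 @ replicate (length xs - count_list xs 0) 1)"
    if "set xs \<subseteq> {0, 1}" for xs :: "nat list"
    using that
  proof (induction xs)
    case (Cons x xs)
    then show ?case by (auto simp: Suc_diff_le)
  qed simp
  then show ?thesis using assms by (auto simp: binary_vectors_def)
qed

lemma symmetric_kernel_eq_profile:
  assumes "symmetric_kernel k \<phi>" "xs \<in> binary_vectors k"
  shows "\<phi> xs = profile k \<phi> (count_list xs 0)"
proof -
  obtain \<pi> where \<pi>: "\<pi> permutes {..<length xs}"
    "permute_list \<pi> xs = replicate (count_list xs 0) 0 @ replicate (k - count_list xs 0) 1"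
    using mset_eq_permutation[OF mset_binary_vector[OF assms(2), symmetric]] by blast
  have "\<phi> (permute_list \<pi> xs) = \<phi> xs"
    using assms \<pi>(1) by (simp add: symmetric_kernel_def binary_vectors_def)
  then show ?thesis unfolding profile_def \<pi>(2) by simp
qed

lemma symmetric_kernelI:
  assumes "\<And>xs. xs \<in> binary_vectors k \<Longrightarrow> \<phi> xs = g (count_list xs 0)"
  shows "symmetric_kernel k \<phi>"
  unfolding symmetric_kernel_def
proof (intro allI impI ballI)
  fix \<pi> and xs :: "nat list" assume \<pi>: "\<pi> permutes {..<k}" and xs: "xs \<in> binary_vectors k"
  then have len: "\<pi> permutes {..<length xs}" by (simp add: binary_vectors_def)
  have "permute_list \<pi> xs \<in> binary_vectors k"
    using xs len by (simp add: binary_vectors_def)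
  moreover have "count_list (permute_list \<pi> xs) 0 = count_list xs 0"
    using mset_permute_list[OF len] by (metis count_mset)
  ultimately show "\<phi> (permute_list \<pi> xs) = \<phi> xs"
    using xs assms by simp
qed

lemma symmetric_kernel_count: "symmetric_kernel k (\<lambda>xs. g (count_list xs 0))"
  by (rule symmetric_kernelI) simp

lemma profile_count: "a \<le> k \<Longrightarrow> profile k (\<lambda>xs. g (count_list xs 0)) a = g a"
  by (simp add: profile_def count_list_eq_length_filter)

lemma count_list_subvector:
  assumes "finite J"
  shows "count_list (subvector X J \<omega>) 0 = card (zero_set X J \<omega>)"
proof -
  have "count_list (subvector X J \<omega>) 0 = length (filter (\<lambda>j. X j \<omega> = 0) (sorted_list_of_set J))"
  proof -
    have "count_list (map (\<lambda>j. X j \<omega>) js) 0 = length (filter (\<lambda>j. X j \<omega> = 0) js)" for js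
      by (induction js) simp_all
    then show ?thesis by (simp add: subvector_def)
  qed
  also have "\<dots> = card (set (filter (\<lambda>j. X j \<omega> = 0) (sorted_list_of_set J)))"
    by (rule distinct_card[symmetric]) simp
  also have "set (filter (\<lambda>j. X j \<omega> = 0) (sorted_list_of_set J)) = zero_set X J \<omega>"
    using assms by (auto simp: zero_set_def)
  finally show ?thesis .
qed

lemma subvector_binary:
  assumes "finite J" "\<And>i. i \<in> J \<Longrightarrow> X i \<omega> \<in> {0, 1}"
  shows "subvector X J \<omega> \<in> binary_vectors (card J)"
proof -
  have "(\<lambda>i. X i \<omega>) ` J \<subseteq> {0, 1}" using assms(2) by (rule image_subsetI)
  then show ?thesis using assms(1) by (simp add: binary_vectors_def subvector_def)
qed

lemma symmetric_kernel_subvector: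
  assumes "symmetric_kernel (card J) \<phi>" "finite J" "\<And>i. i \<in> J \<Longrightarrow> X i \<omega> \<in> {0, 1}"
  shows "\<phi> (subvector X J \<omega>) = profile (card J) \<phi> (card (zero_set X J \<omega>))"
  using symmetric_kernel_eq_profile[OF assms(1) subvector_binary[where X = X and \<omega> = \<omega>, OF assms(2,3)]]
  by (simp add: count_list_subvector assms(2))

lemma U_statistic_eq:
  assumes "symmetric_kernel k \<phi>" and bin: "\<And>i. i \<in> {1..n} \<Longrightarrow> X i \<omega> \<in> {0, 1}"
  shows "U_statistic X n k \<phi> \<omega> =
    (\<Sum>J | J \<subseteq> {1..n} \<and> card J = k. profile k \<phi> (card (zero_set X J \<omega>)))"
  unfolding U_statistic_def
proof (intro sum.cong refl)
  fix J assume "J \<in> {J. J \<subseteq> {1..n} \<and> card J = k}"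
  then have J: "J \<subseteq> {1..n}" "finite J" "card J = k" by (auto intro: finite_subset)
  have J_bin: "X i \<omega> \<in> {0, 1}" if "i \<in> J" for i
    using that J(1) by (intro bin) auto
  have "symmetric_kernel (card J) \<phi>" using J assms(1) by simp
  from symmetric_kernel_subvector[where X = X, OF this J(2) J_bin]
  show "\<phi> (subvector X J \<omega>) = profile k \<phi> (card (zero_set X J \<omega>))"
    using J(3) by simp
qed

text \<open>The symmetric function of the whole vector required by \<open>Ls\<close> is the
  U-statistic evaluated at a fixed vector; it is symmetric because, by the hypergeometric count, it
  depends only on the number of zeros.\<close>

lemma U_statistic_in_Ls:
  assumes sym: "symmetric_kernel k \<phi>"
  shows "U_statistic X n k \<phi> \<in> Ls X n"
proof -
  \<comment> \<open>A fixed vector is regarded as a sequence on the one-point sample space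
    \<open>unit\<close>, so that \<open>U_statistic\<close> applies to it. The index shift
    reconciles sequences starting at 1 with lists starting at 0.\<close>
  define Y :: "nat list \<Rightarrow> nat \<Rightarrow> unit \<Rightarrow> nat" where "Y xs i = (\<lambda>_. xs ! (i - 1))" for xs i
  define T where "T xs = U_statistic (Y xs) n k \<phi> ()" for xs
  have "U_statistic X n k \<phi> \<omega> = T (subvector X {1..n} \<omega>)" for \<omega>
  proof -
    have *: "subvector X {1..n} \<omega> ! (j - 1) = X j \<omega>" if "j \<in> {1..n}" for j
    proof -
      have "{1..n} = {1..<Suc n}" by auto
      then show ?thesis using that by (auto simp: subvector_def simp del: upt_Suc)
    qed
    have "subvector (Y (subvector X {1..n} \<omega>)) J () = subvector X J \<omega>" if "J \<subseteq> {1..n}" for J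
      using that finite_subset[OF that] * by (auto simp: Y_def subvector_def[of _ J])
    then show ?thesis unfolding T_def U_statistic_def by (intro sum.cong) auto
  qed
  moreover have "symmetric_kernel n T"
  proof (rule symmetric_kernelI)
    fix xs assume xs: "xs \<in> binary_vectors n"
    have sub: "subvector (Y xs) {1..n} () = xs"
    proof -
      have "{1..n} = {1..<Suc n}" by auto
      then show ?thesis using xs
        by (auto simp: subvector_def Y_def binary_vectors_def intro!: nth_equalityI simp del: upt_Suc)
    qed
    have bin: "Y xs i () \<in> {0, 1}" if "i \<in> {1..n}" for i
    proof -
      have "xs ! (i - 1) \<in> set xs" using xs that by (intro nth_mem) (auto simp: binary_vectors_def)
      then show ?thesis using xs by (auto simp: binary_vectors_def Y_def)
    qed
    have "T xs = (\<Sum>J | J \<subseteq> {1..n} \<and> card J = k. profile k \<phi> (card (zero_set (Y xs) J ())))"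
      unfolding T_def using sym bin by (rule U_statistic_eq)
    also have "\<dots> = (\<Sum>J | J \<subseteq> {1..n} \<and> card J = k. profile k \<phi> (card (J \<inter> zero_set (Y xs) {1..n} ())))"
      by (intro sum.cong refl arg_cong[of _ _ card] arg_cong[of _ _ "profile k \<phi>"]) (auto simp: zero_set_def)
    also have "\<dots> = (\<Sum>a\<le>k. real ((count_list xs 0 choose a) * ((n - count_list xs 0) choose (k - a))) * profile k \<phi> a)"
    proof -
      have "card (zero_set (Y xs) {1..n} ()) = count_list xs 0"
        using count_list_subvector[of "{1..n}" "Y xs" "()"] unfolding sub by simp
      moreover have "zero_set (Y xs) {1..n} () \<subseteq> {1..n}" by (auto simp: zero_set_def)
      ultimately show ?thesis by (simp add: sum_subsets_card_Int)
    qed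
    finally show "T xs = (\<Sum>a\<le>k. real ((count_list xs 0 choose a) * ((n - count_list xs 0) choose (k - a))) * profile k \<phi> a)" .
  qed
  ultimately show ?thesis unfolding Ls_def by blast
qed

section \<open>Binary vectors encoded by their sets of zeros\<close>

definition zero_vector :: "nat set \<Rightarrow> nat set \<Rightarrow> nat list" where
  "zero_vector J S = map (\<lambda>i. if i \<in> S then 0 else 1) (sorted_list_of_set J)"

lemma zero_vector_inject:
  assumes "finite J" "S \<subseteq> J" "T \<subseteq> J"
  shows "zero_vector J S = zero_vector J T \<longleftrightarrow> S = T"
  using assms by (auto simp: zero_vector_def split: if_splits)

lemma zero_vector_binary: "finite J \<Longrightarrow> zero_vector J S \<in> binary_vectors (card J)"
  by (auto simp: zero_vector_def binary_vectors_def)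

lemma sum_list_zero_vector:
  assumes "finite J" "S \<subseteq> J"
  shows "sum_list (zero_vector J S) = card J - card S"
proof -
  have "sum_list (zero_vector J S) = (\<Sum>i\<in>J. if i \<in> S then 0 else 1)"
    unfolding zero_vector_def using assms by (subst sum_list_distinct_conv_sum_set) auto
  also have "\<dots> = (\<Sum>i\<in>J - S. 1)"
    by (rule sum.mono_neutral_cong_right) (use assms in auto)
  also have "\<dots> = card J - card S"
    using assms finite_subset[OF assms(2,1)] by (simp add: card_Diff_subset)
  finally show ?thesis .
qed

lemma subvector_eq_zero_vector:
  assumes "finite J" "\<And>i. i \<in> J \<Longrightarrow> X i \<omega> \<in> {0, 1}"
  shows "subvector X J \<omega> = zero_vector J (zero_set X J \<omega>)"
  unfolding subvector_def zero_vector_def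
proof (rule map_cong[OF refl])
  fix i assume "i \<in> set (sorted_list_of_set J)"
  then have "i \<in> J" using assms(1) by simp
  then show "X i \<omega> = (if i \<in> zero_set X J \<omega> then 0 else 1)"
    using assms(2)[of i] by (auto simp: zero_set_def)
qed

subsection \<open>Mixtures of Bernoulli sequences\<close>

text \<open>\<open>f a b\<close> is the probability of any given configuration of \<open>a\<close> zeros and \<open>b\<close> ones.\<close>

locale positive_mixture = prob_space M for M :: "'a measure" +
  fixes X :: "nat \<Rightarrow> 'a \<Rightarrow> nat" and f :: "nat \<Rightarrow> nat \<Rightarrow> real"
  assumes X_measurable: "\<And>n. n \<ge> 1 \<Longrightarrow> X n \<in> M \<rightarrow>\<^sub>M count_space {0, 1}"
    and f_pos: "\<And>a b. 0 < f a b"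
    and f_rec: "\<And>a b. f a b = f (Suc a) b + f a (Suc b)"
    and prob_zero_set: "\<And>n S. n \<ge> 1 \<Longrightarrow> S \<subseteq> {1..n} \<Longrightarrow>
      prob {\<omega> \<in> space M. zero_set X {1..n} \<omega> = S} = f (card S) (n - card S)"
begin

lemma X_binary: "i \<ge> 1 \<Longrightarrow> \<omega> \<in> space M \<Longrightarrow> X i \<omega> \<in> {0, 1}"
  using measurable_space[OF X_measurable] by simp

lemma zero_set_measurable:
  assumes "finite V" "0 \<notin> V"
  shows "zero_set X V \<in> M \<rightarrow>\<^sub>M count_space (Pow V)"
proof -
  have ev: "{\<omega> \<in> space M. X i \<omega> = 0} \<in> sets M" if "i \<in> V" for i
  proof -
    have "X i \<in> M \<rightarrow>\<^sub>M count_space {0, 1}" using that assms(2) by (intro X_measurable) (metis Suc_leI One_nat_def neq0_conv)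
    then have "X i -` {0} \<inter> space M \<in> sets M" by (rule measurable_sets) simp
    moreover have "X i -` {0} \<inter> space M = {\<omega> \<in> space M. X i \<omega> = 0}" by auto
    ultimately show ?thesis by simp
  qed
  have "zero_set X V -` {S} \<inter> space M \<in> sets M" if "S \<subseteq> V" for S
  proof -
    have "zero_set X V -` {S} \<inter> space M = {\<omega> \<in> space M. \<forall>i\<in>V. X i \<omega> = 0 \<longleftrightarrow> i \<in> S}"
    proof -
      have "zero_set X V \<omega> = S \<longleftrightarrow> (\<forall>i\<in>V. X i \<omega> = 0 \<longleftrightarrow> i \<in> S)" for \<omega>
        using that unfolding zero_set_def by blast
      then show ?thesis by (simp add: vimage_def Int_def conj_commute)
    qed
    also have "\<dots> \<in> sets M"
    proof (intro sets.sets_Collect_finite_All assms(1))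
      fix i assume "i \<in> V"
      then show "{\<omega> \<in> space M. X i \<omega> = 0 \<longleftrightarrow> i \<in> S} \<in> sets M"
        using ev[of i] sets.sets_Collect_neg[OF ev[of i]] by (cases "i \<in> S") auto
    qed
    finally show ?thesis .
  qed
  moreover have "zero_set X V \<in> space M \<rightarrow> Pow V" by (auto simp: zero_set_def)
  ultimately show ?thesis
    using assms(1) by (simp add: measurable_count_space_eq2)
qed

lemma integrable_zero_set:
  fixes g :: "nat set \<Rightarrow> real"
  assumes "finite V" "0 \<notin> V"
  shows "integrable M (\<lambda>\<omega>. g (zero_set X V \<omega>))"
proof (rule integrable_const_bound)
  show "AE \<omega> in M. norm (g (zero_set X V \<omega>)) \<le> (\<Sum>S\<in>Pow V. \<bar>g S\<bar>)"
    using assms by (intro AE_I2) (auto intro!: member_le_sum simp: zero_set_def)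
  show "(\<lambda>\<omega>. g (zero_set X V \<omega>)) \<in> borel_measurable M"
    using measurable_compose[OF zero_set_measurable[OF assms], of g borel] by simp
qed

text \<open>This is \<open>f_rec\<close> iterated: summing over all values of the coordinates in
  \<open>W\<close> leaves the weight of the remaining \<open>a + b\<close> coordinates.\<close>

lemma sum_weights:
  assumes "finite W"
  shows "(\<Sum>T\<in>Pow W. f (a + card T) (b + card W - card T)) = f a b"
  using assms
proof (induction W arbitrary: b rule: finite_induct)
  case (insert x W)
  have "(\<Sum>T\<in>Pow (insert x W). f (a + card T) (b + card (insert x W) - card T)) =
    (\<Sum>T\<in>Pow W. f (a + card T) (b + card W - card T))"
  proof (subst sum_Pow_insert, goal_cases)
    case 3
    show ?case
    proof (intro sum.cong refl)
      fix T assume "T \<in> Pow W"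
      then have "card T \<le> card W" "finite T" "x \<notin> T" using insert by (auto intro: card_mono finite_subset)
      then show "f (a + card T) (b + card (insert x W) - card T) +
          f (a + card (insert x T)) (b + card (insert x W) - card (insert x T)) =
        f (a + card T) (b + card W - card T)"
        using f_rec[of "a + card T" "b + card W - card T"] insert by (simp add: Suc_diff_le)
    qed
  qed (use insert in auto)
  with insert.IH show ?case by simp
qed simp

text \<open>The law is given on initial segments only. An arbitrary index set \<open>V\<close> is
  embedded in some \<open>{1..n}\<close> and the remaining coordinates are summed out, so only the
  size of \<open>V\<close> matters for the weights.\<close>

lemma expectation_zero_set:
  assumes "finite V" "0 \<notin> V"
  shows "(\<integral>\<omega>. g (zero_set X V \<omega>) \<partial>M) = (\<Sum>S\<in>Pow V. f (card S) (card V - card S) * g S)"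
proof -
  obtain m where m: "\<And>i. i \<in> V \<Longrightarrow> i \<le> m" using finite_nat_set_iff_bounded_le assms(1) by auto
  \<comment> \<open>The successor ensures \<open>n \<ge> 1\<close>, as \<open>prob_zero_set\<close>
    demands, even if \<open>V\<close> is empty.\<close>
  define n where "n = Suc m"
  have V: "V \<subseteq> {1..n}"
  proof
    fix i assume "i \<in> V"
    then show "i \<in> {1..n}" using m[of i] assms(2) by (cases i) (auto simp: n_def)
  qed
  define W where "W = {1..n} - V"
  have W: "{1..n} = V \<union> W" "V \<inter> W = {}" "finite W" using V by (auto simp: W_def)
  define A where "A S = {\<omega> \<in> space M. zero_set X {1..n} \<omega> = S}" for S
  have A: "A S \<in> sets M" if "S \<subseteq> {1..n}" for S
    using measurable_sets[OF zero_set_measurable[of "{1..n}"], of "{S}"] that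
    by (simp add: A_def vimage_def Int_def conj_commute)
  have "(\<integral>\<omega>. g (zero_set X V \<omega>) \<partial>M) =
    (\<integral>\<omega>. (\<Sum>S\<in>Pow {1..n}. g (V \<inter> S) * indicator (A S) \<omega>) \<partial>M)"
  proof (intro Bochner_Integration.integral_cong refl)
    fix \<omega> assume \<omega>: "\<omega> \<in> space M"
    have "(\<Sum>S\<in>Pow {1..n}. g (V \<inter> S) * indicator (A S) \<omega>) =
      (\<Sum>S\<in>Pow {1..n}. if S = zero_set X {1..n} \<omega> then g (V \<inter> S) else 0)"
      using \<omega> by (intro sum.cong refl) (auto simp: indicator_def A_def)
    also have "\<dots> = g (V \<inter> zero_set X {1..n} \<omega>)"
      by (subst sum.delta) (auto simp: zero_set_def)
    finally show "g (zero_set X V \<omega>) =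
        (\<Sum>S\<in>Pow {1..n}. g (V \<inter> S) * indicator (A S) \<omega>)"
      using zero_set_subset[OF V, of X \<omega>] by simp
  qed
  also have "\<dots> = (\<Sum>S\<in>Pow {1..n}. g (V \<inter> S) * f (card S) (n - card S))"
  proof (subst Bochner_Integration.integral_sum, goal_cases)
    case (1 S)
    then show ?case
      using A by (intro integrable_mult_right integrable_real_indicator) (auto simp flip: less_top)
  next
    case 2
    have "prob (A S) = f (card S) (n - card S)" "A S \<inter> space M = A S" if "S \<in> Pow {1..n}" for S
      using prob_zero_set[of n S] that by (auto simp: A_def n_def)
    then show ?case by (intro sum.cong refl) simp
  qed
  also have "\<dots> = (\<Sum>S\<in>Pow V. \<Sum>T\<in>Pow W. g (V \<inter> (S \<union> T)) * f (card (S \<union> T)) (n - card (S \<union> T)))"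
    using W assms unfolding W(1) by (subst sum_Pow_Un) auto
  also have "\<dots> = (\<Sum>S\<in>Pow V. \<Sum>T\<in>Pow W. g S * f (card S + card T) (card V - card S + card W - card T))"
  proof (intro sum.cong refl)
    fix S T assume ST: "S \<in> Pow V" "T \<in> Pow W"
    have "card (S \<union> T) = card S + card T"
      using ST W assms by (intro card_Un_disjoint) (auto intro: finite_subset)
    moreover have "V \<inter> (S \<union> T) = S" using ST W by auto
    moreover have "card V + card W = n" using card_Un_disjoint[of V W] W(2,3) assms unfolding W(1)[symmetric] by simp
    moreover have "card S \<le> card V" using ST assms by (auto intro: card_mono)
    ultimately show "g (V \<inter> (S \<union> T)) * f (card (S \<union> T)) (n - card (S \<union> T)) =
        g S * f (card S + card T) (card V - card S + card W - card T)"
      by (auto intro!: arg_cong[of _ _ "f _"])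
  qed
  also have "\<dots> = (\<Sum>S\<in>Pow V. f (card S) (card V - card S) * g S)"
    using W by (simp add: sum_weights mult.commute flip: sum_distrib_left)
  finally show ?thesis .
qed


lemma prob_zero_set_event:
  assumes "finite V" "0 \<notin> V"
  shows "prob {\<omega> \<in> space M. Q (zero_set X V \<omega>)} =
    (\<Sum>S\<in>Pow V. f (card S) (card V - card S) * (if Q S then 1 else 0))"
proof -
  have "{\<omega> \<in> space M. Q (zero_set X V \<omega>)} = zero_set X V -` {S \<in> Pow V. Q S} \<inter> space M"
    by (auto simp: zero_set_def)
  also have "\<dots> \<in> sets M"
    by (rule measurable_sets[OF zero_set_measurable[OF assms]]) auto
  finally have "prob {\<omega> \<in> space M. Q (zero_set X V \<omega>)} =
      (\<integral>\<omega>. indicator {\<omega> \<in> space M. Q (zero_set X V \<omega>)} \<omega> \<partial>M)"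
    by (simp add: Int_absorb2)
  also have "\<dots> = (\<integral>\<omega>. (if Q (zero_set X V \<omega>) then 1 else 0) \<partial>M)"
    by (intro Bochner_Integration.integral_cong) (auto simp: indicator_def)
  also have "\<dots> = (\<Sum>S\<in>Pow V. f (card S) (card V - card S) * (if Q S then 1 else 0))"
    using assms by (rule expectation_zero_set[where g = "\<lambda>S. if Q S then 1 else 0"])
  finally show ?thesis .
qed

subsection \<open>The bilinear form of two U-statistics\<close>

text \<open>\<open>pairing k u g h\<close> is the expectation of \<open>g(X\<^sub>J) h(X\<^sub>L)\<close> for index sets \<open>J\<close> and \<open>L\<close> of sizes
  \<open>k\<close> and \<open>k - 1\<close> such that \<open>J - L\<close> has \<open>u\<close> elements; \<open>a\<close>, \<open>b\<close>, \<open>c\<close> count the zeros in \<open>J - L\<close>,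
  \<open>J \<inter> L\<close> and \<open>L - J\<close>.\<close>

definition pairing :: "nat \<Rightarrow> nat \<Rightarrow> (nat \<Rightarrow> real) \<Rightarrow> (nat \<Rightarrow> real) \<Rightarrow> real" where
  "pairing k u g h =
    (\<Sum>a\<le>u. real (u choose a) * (\<Sum>b\<le>k - u. real ((k - u) choose b) *
      (\<Sum>c\<le>u - 1. real ((u - 1) choose c) *
        (f (a + b + c) (k + u - 1 - (a + b + c)) * (g (a + b) * h (b + c))))))"

lemma pairing_cong:
  assumes "1 \<le> u" "u \<le> k" "\<And>a. a \<le> k \<Longrightarrow> g a = g' a" "\<And>a. a \<le> k - 1 \<Longrightarrow> h a = h' a"
  shows "pairing k u g h = pairing k u g' h'"
  unfolding pairing_def using assms
  by (intro sum.cong refl arg_cong2[of _ _ _ _ "(*)"]) auto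

lemma pairing_scale_left: "pairing k u (\<lambda>a. c * g a) h = c * pairing k u g h"
  unfolding pairing_def by (simp add: sum_distrib_left mult_ac)

lemma pairing_scale_right: "pairing k u g (\<lambda>a. c * h a) = c * pairing k u g h"
  unfolding pairing_def by (simp add: sum_distrib_left mult_ac)

lemma pairing_add_right: "pairing k u g (\<lambda>a. h a + h' a) = pairing k u g h + pairing k u g h'"
  unfolding pairing_def by (simp add: sum.distrib algebra_simps)

lemma pairing_sum_right:
  "finite Z \<Longrightarrow> pairing k u g (\<lambda>a. \<Sum>z\<in>Z. h z a) = (\<Sum>z\<in>Z. pairing k u g (h z))"
proof (induction Z rule: finite_induct)
  case empty
  show ?case by (simp add: pairing_def)
qed (simp add: pairing_add_right)

text \<open>The form is linear in \<open>h\<close> and reads \<open>h\<close> only at arguments up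
  to \<open>k - 1\<close>, so it suffices to test point masses.\<close>

lemma pairing_eq_0_iff:
  assumes "1 \<le> u" "u \<le> k"
  shows "(\<forall>h. pairing k u g h = 0) \<longleftrightarrow> (\<forall>z\<le>k - 1. pairing k u g (\<lambda>a. if a = z then 1 else 0) = 0)"
proof (intro iffI allI)
  fix h assume *: "\<forall>z\<le>k - 1. pairing k u g (\<lambda>a. if a = z then 1 else 0) = 0"
  have "pairing k u g h = pairing k u g (\<lambda>a. \<Sum>z\<in>{..k - 1}. h z * (if a = z then 1 else 0))"
    using assms by (intro pairing_cong) (auto simp: sum.delta' if_distrib cong: if_cong)
  also have "\<dots> = 0"
    using * by (subst pairing_sum_right) (auto simp: pairing_scale_right)
  finally show "pairing k u g h = 0" .
qed simp

text \<open>The union of \<open>J\<close> and \<open>L\<close> splits into \<open>J - L\<close>,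
  \<open>J \<inter> L\<close> and \<open>L - J\<close>. The weight of a configuration and both
  factors depend only on the numbers of zeros in these three blocks.\<close>

lemma expectation_pair:
  assumes fin: "finite J" "finite L" and "0 \<notin> J" "0 \<notin> L" and card: "card J = k" "card L = k - 1" "k \<ge> 1"
  shows "(\<integral>\<omega>. g (card (zero_set X J \<omega>)) * h (card (zero_set X L \<omega>)) \<partial>M) = pairing k (card (J - L)) g h"
proof -
  define u where "u = card (J - L)"
  have J: "card (J - L) + card (J \<inter> L) = k"
    using card_Un_disjoint[of "J - L" "J \<inter> L"] fin card by (simp add: Un_Diff_Int) (metis Int_Diff_disjoint Int_commute)
  have L: "card (L - J) + card (J \<inter> L) = k - 1"
    using card_Un_disjoint[of "L - J" "J \<inter> L"] fin card
    by (metis Int_Diff_disjoint Int_commute Un_Diff_Int finite_Diff finite_Int)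
  \<comment> \<open>Since \<open>L\<close> has one element less than \<open>J\<close>, the block
    \<open>L - J\<close> is smaller than \<open>J - L\<close> by one, and \<open>J - L\<close> is
    nonempty.\<close>
  have c: "card (J - L) = u" "card (J \<inter> L) = k - u" "card (L - J) = u - 1" "1 \<le> u" "u \<le> k"
    using J L card unfolding u_def by auto
  define V where "V = (J - L) \<union> ((J \<inter> L) \<union> (L - J))"
  have V: "J \<subseteq> V" "L \<subseteq> V" "finite V" "0 \<notin> V" using assms by (auto simp: V_def)
  have cV: "card V = k + u - 1"
  proof -
    have "card V = card (J - L) + (card (J \<inter> L) + card (L - J))"
      unfolding V_def using fin by (subst card_Un_disjoint; auto)+
    then show ?thesis using c by simp
  qed
  have "(\<integral>\<omega>. g (card (zero_set X J \<omega>)) * h (card (zero_set X L \<omega>)) \<partial>M) =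
      (\<integral>\<omega>. g (card (J \<inter> zero_set X V \<omega>)) * h (card (L \<inter> zero_set X V \<omega>)) \<partial>M)"
    using zero_set_subset[OF V(1), of X] zero_set_subset[OF V(2), of X] by simp
  also have "\<dots> = (\<Sum>S\<in>Pow V. f (card S) (card V - card S) * (g (card (J \<inter> S)) * h (card (L \<inter> S))))"
    using V(3,4) by (rule expectation_zero_set[where g = "\<lambda>S. g (card (J \<inter> S)) * h (card (L \<inter> S))"])
  also have "\<dots> = (\<Sum>A\<in>Pow (J - L). \<Sum>B\<in>Pow (J \<inter> L). \<Sum>C\<in>Pow (L - J).
      f (card (A \<union> (B \<union> C))) (card V - card (A \<union> (B \<union> C))) *
        (g (card (J \<inter> (A \<union> (B \<union> C)))) * h (card (L \<inter> (A \<union> (B \<union> C))))))"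
    using fin unfolding V_def by (subst sum_Pow_Un; (subst sum_Pow_Un)?; auto)
  also have "\<dots> = (\<Sum>A\<in>Pow (J - L). \<Sum>B\<in>Pow (J \<inter> L). \<Sum>C\<in>Pow (L - J).
      f (card A + card B + card C) (k + u - 1 - (card A + card B + card C)) *
        (g (card A + card B) * h (card B + card C)))"
  proof (intro sum.cong refl)
    fix A B C assume ABC: "A \<in> Pow (J - L)" "B \<in> Pow (J \<inter> L)" "C \<in> Pow (L - J)"
    then have fABC: "finite A" "finite B" "finite C" using fin by (auto intro: finite_subset)
    have e: "J \<inter> (A \<union> (B \<union> C)) = A \<union> B" "L \<inter> (A \<union> (B \<union> C)) = B \<union> C" using ABC by auto
    have d: "A \<inter> B = {}" "B \<inter> C = {}" "A \<inter> (B \<union> C) = {}" using ABC by auto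
    show "f (card (A \<union> (B \<union> C))) (card V - card (A \<union> (B \<union> C))) *
          (g (card (J \<inter> (A \<union> (B \<union> C)))) * h (card (L \<inter> (A \<union> (B \<union> C))))) =
        f (card A + card B + card C) (k + u - 1 - (card A + card B + card C)) *
          (g (card A + card B) * h (card B + card C))"
      unfolding e cV using fABC d by (simp add: card_Un_disjoint add.assoc)
  qed
  also have "\<dots> = pairing k u g h"
    unfolding pairing_def using fin
    by (subst sum_Pow_card3[where g = "\<lambda>a b c. f (a + b + c) (k + u - 1 - (a + b + c)) * (g (a + b) * h (b + c))"])
      (simp_all add: c)
  finally show ?thesis by (simp add: u_def)
qed

lemma U_statistic_zero_set:
  assumes "symmetric_kernel k \<phi>" "\<omega> \<in> space M"
  shows "U_statistic X n k \<phi> \<omega> =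
    (\<Sum>J | J \<subseteq> {1..n} \<and> card J = k. profile k \<phi> (card (zero_set X J \<omega>)))"
  using assms X_binary by (intro U_statistic_eq) auto

lemma expectation_U_statistics:
  assumes "symmetric_kernel k \<phi>" "symmetric_kernel (k - 1) \<psi>" "k \<ge> 1"
  shows "(\<integral>\<omega>. U_statistic X n k \<phi> \<omega> * U_statistic X n (k - 1) \<psi> \<omega> \<partial>M) =
    (\<Sum>J | J \<subseteq> {1..n} \<and> card J = k. \<Sum>L | L \<subseteq> {1..n} \<and> card L = k - 1.
      pairing k (card (J - L)) (profile k \<phi>) (profile (k - 1) \<psi>))"
proof -
  have fin: "finite J" "0 \<notin> J" if "J \<subseteq> {1..n}" for J using that by (auto intro: finite_subset)
  have int: "integrable M (\<lambda>\<omega>. profile k \<phi> (card (zero_set X J \<omega>)) * profile (k - 1) \<psi> (card (zero_set X L \<omega>)))"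
    if "J \<subseteq> {1..n}" "L \<subseteq> {1..n}" for J L
  proof -
    have "integrable M (\<lambda>\<omega>. profile k \<phi> (card (J \<inter> zero_set X {1..n} \<omega>)) * profile (k - 1) \<psi> (card (L \<inter> zero_set X {1..n} \<omega>)))"
      by (rule integrable_zero_set[where g = "\<lambda>S. profile k \<phi> (card (J \<inter> S)) * profile (k - 1) \<psi> (card (L \<inter> S))"]) auto
    then show ?thesis
      using zero_set_subset[OF that(1), of X] zero_set_subset[OF that(2), of X] by simp
  qed
  have "(\<integral>\<omega>. U_statistic X n k \<phi> \<omega> * U_statistic X n (k - 1) \<psi> \<omega> \<partial>M) =
    (\<integral>\<omega>. (\<Sum>J | J \<subseteq> {1..n} \<and> card J = k. \<Sum>L | L \<subseteq> {1..n} \<and> card L = k - 1.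
      profile k \<phi> (card (zero_set X J \<omega>)) * profile (k - 1) \<psi> (card (zero_set X L \<omega>))) \<partial>M)"
    using assms by (intro Bochner_Integration.integral_cong refl) (simp add: U_statistic_zero_set sum_product)
  also have "\<dots> = (\<Sum>J | J \<subseteq> {1..n} \<and> card J = k. \<Sum>L | L \<subseteq> {1..n} \<and> card L = k - 1.
      \<integral>\<omega>. profile k \<phi> (card (zero_set X J \<omega>)) * profile (k - 1) \<psi> (card (zero_set X L \<omega>)) \<partial>M)"
    using int by (subst Bochner_Integration.integral_sum; (intro sum.cong refl Bochner_Integration.integral_sum)?; auto)
  also have "\<dots> = (\<Sum>J | J \<subseteq> {1..n} \<and> card J = k. \<Sum>L | L \<subseteq> {1..n} \<and> card L = k - 1.
      pairing k (card (J - L)) (profile k \<phi>) (profile (k - 1) \<psi>))"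
    using fin assms(3) by (intro sum.cong refl expectation_pair) auto
  finally show ?thesis .
qed

text \<open>Membership in \<open>SU X n k\<close> and in \<open>Ls X n\<close> is automatic, so only
  the orthogonality remains.\<close>

lemma U_statistic_in_SH_iff:
  assumes "symmetric_kernel k \<phi>"
  shows "U_statistic X n k \<phi> \<in> SH M X n k \<longleftrightarrow>
    (\<forall>\<psi>. symmetric_kernel (k - 1) \<psi> \<longrightarrow>
      (\<integral>\<omega>. U_statistic X n k \<phi> \<omega> * U_statistic X n (k - 1) \<psi> \<omega> \<partial>M) = 0)"
  using assms U_statistic_in_Ls[OF assms, of X n] unfolding SH_def orth_Ls_def SU_def by auto

subsection \<open>Degenerate kernels\<close>

definition degenerate_kernel :: "nat \<Rightarrow> nat \<Rightarrow> real" where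
  "degenerate_kernel k a = (- 1) ^ a / f a (k - a)"

text \<open>The recursion says that \<open>p a * f a (k - a)\<close> changes sign at each step. As
  all weights are positive, its solutions form a line. The two summands will correspond to
  \<open>X 1\<close> being zero or one when the other \<open>k - 1\<close> variables contain
  \<open>a\<close> zeros.\<close>

lemma degenerate_recursion_iff:
  "(\<forall>a<k. p (Suc a) * f (Suc a) (k - 1 - a) + p a * f a (k - a) = 0) \<longleftrightarrow>
    (\<exists>c. \<forall>a\<le>k. p a = c * degenerate_kernel k a)"
proof
  assume rec: "\<forall>a<k. p (Suc a) * f (Suc a) (k - 1 - a) + p a * f a (k - a) = 0"
  \<comment> \<open>The constant is forced by \<open>a = 0\<close>, where the degenerate kernel
    equals \<open>1 / f 0 k\<close>.\<close>
  have "p a = p 0 * f 0 k * degenerate_kernel k a" if "a \<le> k" for a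
    using that
  proof (induction a)
    case 0
    then show ?case using f_pos[of 0 k] by (simp add: degenerate_kernel_def)
  next
    case (Suc a)
    have e: "k - 1 - a = k - Suc a" by simp
    have "p (Suc a) * f (Suc a) (k - Suc a) = - (p a * f a (k - a))"
      using rec[rule_format, of a] Suc.prems unfolding e by linarith
    also have "\<dots> = - ((- 1) ^ a * (p 0 * f 0 k))"
      using Suc f_pos[of a "k - a"] by (simp add: degenerate_kernel_def)
    finally show ?case
      using f_pos[of "Suc a" "k - Suc a"] by (simp add: degenerate_kernel_def field_simps)
  qed
  then show "\<exists>c. \<forall>a\<le>k. p a = c * degenerate_kernel k a" by blast
next
  assume "\<exists>c. \<forall>a\<le>k. p a = c * degenerate_kernel k a"
  then obtain c where c: "\<And>a. a \<le> k \<Longrightarrow> p a = c * degenerate_kernel k a" by blast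
  have nz: "f a b \<noteq> 0" for a b using f_pos[of a b] by simp
  show "\<forall>a<k. p (Suc a) * f (Suc a) (k - 1 - a) + p a * f a (k - a) = 0"
    using c nz by (auto simp: degenerate_kernel_def)
qed

lemma expectation_zero_set_kernel:
  assumes "k \<ge> 1"
  shows "(\<integral>\<omega>. q (zero_set X {2..k} \<omega>) * p (card (zero_set X {1..k} \<omega>)) \<partial>M) =
    (\<Sum>S\<in>Pow {2..k}. q S * (p (Suc (card S)) * f (Suc (card S)) (k - 1 - card S) + p (card S) * f (card S) (k - card S)))"
proof -
  have ins: "{1..k} = insert 1 {2..k}" using assms by auto
  have sub: "{2..k} \<subseteq> {1..k}" by auto
  have "(\<integral>\<omega>. q (zero_set X {2..k} \<omega>) * p (card (zero_set X {1..k} \<omega>)) \<partial>M) =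
      (\<Sum>S\<in>Pow {1..k}. f (card S) (card {1..k} - card S) * (q ({2..k} \<inter> S) * p (card S)))"
    unfolding zero_set_subset[OF sub]
    by (rule expectation_zero_set[where g = "\<lambda>S. q ({2..k} \<inter> S) * p (card S)"]) auto
  also have "\<dots> = (\<Sum>S\<in>Pow {2..k}. f (card S) (k - card S) * (q ({2..k} \<inter> S) * p (card S)) +
      f (card (insert 1 S)) (k - card (insert 1 S)) * (q ({2..k} \<inter> insert 1 S) * p (card (insert 1 S))))"
  proof -
    have "card {1..k} = k" by simp
    then show ?thesis unfolding ins by (subst sum_Pow_insert) auto
  qed
  also have "\<dots> = (\<Sum>S\<in>Pow {2..k}. q S * (p (Suc (card S)) * f (Suc (card S)) (k - 1 - card S) + p (card S) * f (card S) (k - card S)))"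
  proof (intro sum.cong refl)
    fix S :: "nat set" assume S: "S \<in> Pow {2..k}"
    then have "finite S" "1 \<notin> S" "{2..k} \<inter> S = S" "{2..k} \<inter> insert 1 S = S" by (auto intro: finite_subset)
    then show "f (card S) (k - card S) * (q ({2..k} \<inter> S) * p (card S)) +
      f (card (insert 1 S)) (k - card (insert 1 S)) * (q ({2..k} \<inter> insert 1 S) * p (card (insert 1 S))) =
      q S * (p (Suc (card S)) * f (Suc (card S)) (k - 1 - card S) + p (card S) * f (card S) (k - card S))"
      by (simp add: algebra_simps)
  qed
  finally show ?thesis .
qed

text \<open>The conditioning algebra is generated by the finitely many events that fix the zeros
  among the coordinates \<open>2..k\<close>. The conditional expectation vanishes iff the integral
  of the kernel over each of these events does, and this is the recursion for the degenerate
  kernel.\<close>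

lemma cond_exp_kernel_eq_0_iff:
  assumes k: "k \<ge> 1" and sym: "symmetric_kernel k \<phi>"
  shows "(AE \<omega> in M. real_cond_exp M (sigma_of_vector M X {2..k}) (\<lambda>\<omega>. \<phi> (subvector X {1..k} \<omega>)) \<omega> = 0) \<longleftrightarrow>
    (\<exists>c. \<forall>a\<le>k. profile k \<phi> a = c * degenerate_kernel k a)"
proof -
  define p where "p = profile k \<phi>"
  define F where "F = sigma_of_vector M X {2..k}"
  define Y where "Y = (\<lambda>\<omega>. \<phi> (subvector X {1..k} \<omega>))"
  \<comment> \<open>\<open>D a\<close> is the integral of the kernel over an event fixing
    \<open>a\<close> zeros among the coordinates \<open>2..k\<close>.\<close>
  define D where "D a = p (Suc a) * f (Suc a) (k - 1 - a) + p a * f a (k - a)" for a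
  have sub_measurable: "subvector X {2..k} \<in> M \<rightarrow>\<^sub>M count_space UNIV"
    by (rule measurable_subvector[OF X_measurable]) auto
  have sets_F: "sets F = {subvector X {2..k} -` A \<inter> space M | A. A \<in> UNIV}"
    unfolding F_def sigma_of_vector_def by (subst sets_vimage_algebra2) auto
  have space_F: "space F = space M" by (simp add: F_def sigma_of_vector_def)
  interpret finite_measure_subalgebra M F
  proof
    show "subalgebra M F"
      unfolding subalgebra_def sets_F space_F using measurable_sets[OF sub_measurable] by auto
  qed
  have Y: "Y \<omega> = p (card (zero_set X {1..k} \<omega>))" if "\<omega> \<in> space M" for \<omega>
    unfolding Y_def p_def
    using symmetric_kernel_subvector[of "{1..k}" \<phi> X \<omega>] sym X_binary that by simp
  have int_Y: "integrable M Y"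
  proof -
    have "integrable M (\<lambda>\<omega>. p (card (zero_set X {1..k} \<omega>)))"
      by (rule integrable_zero_set[where g = "\<lambda>S. p (card S)"]) auto
    then show ?thesis by (subst Bochner_Integration.integrable_cong[OF refl Y])
  qed
  have vec: "subvector X {2..k} \<omega> = zero_vector {2..k} (zero_set X {2..k} \<omega>)" if "\<omega> \<in> space M" for \<omega>
    using X_binary that by (intro subvector_eq_zero_vector) auto
  have set_integral: "(\<integral>\<omega>\<in>subvector X {2..k} -` B \<inter> space M. Y \<omega> \<partial>M) =
      (\<Sum>S\<in>Pow {2..k}. indicator B (zero_vector {2..k} S) * D (card S))" for B
  proof -
    have "(\<integral>\<omega>\<in>subvector X {2..k} -` B \<inter> space M. Y \<omega> \<partial>M) =
        (\<integral>\<omega>. indicator B (zero_vector {2..k} (zero_set X {2..k} \<omega>)) * p (card (zero_set X {1..k} \<omega>)) \<partial>M)"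
      unfolding set_lebesgue_integral_def
      by (intro Bochner_Integration.integral_cong refl) (auto simp: Y vec indicator_def)
    also have "\<dots> = (\<Sum>S\<in>Pow {2..k}. indicator B (zero_vector {2..k} S) * D (card S))"
      unfolding D_def by (rule expectation_zero_set_kernel[OF k, where q = "\<lambda>S. indicator B (zero_vector {2..k} S)"])
    finally show ?thesis .
  qed
  have "(AE \<omega> in M. real_cond_exp M F Y \<omega> = 0) \<longleftrightarrow> (\<forall>a<k. D a = 0)"
  proof
    assume ae: "AE \<omega> in M. real_cond_exp M F Y \<omega> = 0"
    show "\<forall>a<k. D a = 0"
    proof (intro allI impI)
      fix a assume "a < k"
      then have "a \<le> card {2..k}" by simp
      then obtain S where S: "S \<subseteq> {2..k}" "card S = a"
        by (rule obtain_subset_with_card_n)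
      define A where "A = subvector X {2..k} -` {zero_vector {2..k} S} \<inter> space M"
      have A: "A \<in> sets F" unfolding sets_F A_def by auto
      have "(\<integral>\<omega>\<in>A. Y \<omega> \<partial>M) = (\<integral>\<omega>\<in>A. real_cond_exp M F Y \<omega> \<partial>M)"
        by (rule real_cond_exp_intA[OF int_Y A])
      also have "\<dots> = 0"
        unfolding set_lebesgue_integral_def using ae by (intro integral_eq_zero_AE) auto
      finally have "0 = (\<Sum>T\<in>Pow {2..k}. indicator {zero_vector {2..k} S} (zero_vector {2..k} T) * D (card T))"
        unfolding A_def set_integral by simp
      also have "\<dots> = (\<Sum>T\<in>Pow {2..k}. if T = S then D (card T) else 0)"
        using S(1) zero_vector_inject[of "{2..k}" _ S] by (intro sum.cong refl) (auto simp: indicator_def)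
      also have "\<dots> = D a" using S by (simp add: sum.delta)
      finally show "D a = 0" by simp
    qed
  next
    assume D: "\<forall>a<k. D a = 0"
    show "AE \<omega> in M. real_cond_exp M F Y \<omega> = 0"
    \<comment> \<open>Zero satisfies the defining property of the conditional expectation: every set
      of the algebra integrates the kernel to a sum of values \<open>D (card S)\<close> with
      \<open>card S < k\<close>.\<close>
    proof (rule real_cond_exp_charact)
      fix A assume "A \<in> sets F"
      then obtain B where A: "A = subvector X {2..k} -` B \<inter> space M" unfolding sets_F by auto
      have "D (card S) = 0" if "S \<in> Pow {2..k}" for S :: "nat set"
      proof -
        have "card S \<le> card {2..k}" using that by (intro card_mono) auto
        then show ?thesis using k D by auto
      qed
      then show "(\<integral>\<omega>\<in>A. Y \<omega> \<partial>M) = (\<integral>\<omega>\<in>A. 0 \<partial>M)"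
        unfolding A set_integral by (simp add: set_lebesgue_integral_def)
    qed (use int_Y in auto)
  qed
  then show ?thesis
    unfolding F_def Y_def D_def degenerate_recursion_iff p_def .
qed

text \<open>For \<open>u = 1\<close> the set \<open>L\<close> lies in \<open>J\<close>, and summing
  over the value of the single extra coordinate produces \<open>(- 1) ^ b\<close> and
  \<open>(- 1) ^ Suc b\<close>, which cancel.\<close>

lemma pairing_degenerate_1:
  assumes "k \<ge> 1"
  shows "pairing k 1 (degenerate_kernel k) h = 0"
proof -
  have nz: "f a b \<noteq> 0" for a b using f_pos[of a b] by simp
  have "{..1::nat} = {0, 1}" by auto
  then have "pairing k 1 (degenerate_kernel k) h =
      (\<Sum>b\<le>k - 1. real ((k - 1) choose b) * (f b (k - b) * (degenerate_kernel k b * h b))) +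
      (\<Sum>b\<le>k - 1. real ((k - 1) choose b) * (f (Suc b) (k - Suc b) * (degenerate_kernel k (Suc b) * h b)))"
    by (simp add: pairing_def)
  also have "\<dots> = 0"
    unfolding degenerate_kernel_def sum.distrib[symmetric] using nz by (intro sum.neutral ballI) simp
  finally show ?thesis .
qed

text \<open>Deleting one coordinate from a vector with \<open>a\<close> zeros leaves
  \<open>a\<close> zeros in \<open>k - a\<close> cases and \<open>a - 1\<close> in the other
  \<open>a\<close> cases, so \<open>lift\<close> says that the kernel sums \<open>\<psi>\<close>
  over all deletions. Each \<open>L\<close> is then counted \<open>n + 1 - k\<close> times. In this
  way elements of \<open>SU X n (k - 1)\<close> acquire kernels of \<open>k\<close>
  variables.\<close>

lemma U_statistic_lift:
  assumes k: "1 \<le> k" "k \<le> n" and sym: "symmetric_kernel k \<eta>" "symmetric_kernel (k - 1) \<psi>"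
    and lift: "\<And>a. a \<le> k \<Longrightarrow>
      profile k \<eta> a = real (k - a) * profile (k - 1) \<psi> a + real a * profile (k - 1) \<psi> (a - 1)"
    and \<omega>: "\<omega> \<in> space M"
  shows "U_statistic X n k \<eta> \<omega> = real (n + 1 - k) * U_statistic X n (k - 1) \<psi> \<omega>"
proof -
  have "U_statistic X n k \<eta> \<omega> =
      (\<Sum>J | J \<subseteq> {1..n} \<and> card J = k. \<Sum>j\<in>J. profile (k - 1) \<psi> (card (zero_set X (J - {j}) \<omega>)))"
    unfolding U_statistic_zero_set[OF sym(1) \<omega>]
  proof (intro sum.cong refl)
    fix J assume "J \<in> {J. J \<subseteq> {1..n} \<and> card J = k}"
    then have J: "finite J" "card J = k" by (auto intro: finite_subset)
    define Z where "Z = zero_set X J \<omega>"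
    have Z: "Z \<subseteq> J" "finite Z" using J by (auto simp: Z_def zero_set_def)
    have cZ: "card Z \<le> k" using card_mono[OF J(1) Z(1)] J(2) by simp
    have e: "zero_set X (J - {j}) \<omega> = Z - {j}" for j by (auto simp: Z_def zero_set_def)
    have "(\<Sum>j\<in>J. profile (k - 1) \<psi> (card (Z - {j}))) =
        (\<Sum>j\<in>J - Z. profile (k - 1) \<psi> (card (Z - {j}))) + (\<Sum>j\<in>Z. profile (k - 1) \<psi> (card (Z - {j})))"
      using sum.subset_diff[OF Z(1) J(1)] .
    also have "\<dots> = (\<Sum>j\<in>J - Z. profile (k - 1) \<psi> (card Z)) + (\<Sum>j\<in>Z. profile (k - 1) \<psi> (card Z - 1))"
      using Z by (intro arg_cong2[of _ _ _ _ "(+)"] sum.cong refl) auto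
    also have "\<dots> = profile k \<eta> (card Z)"
      using Z J lift[OF cZ] by (simp add: card_Diff_subset)
    finally show "profile k \<eta> (card (zero_set X J \<omega>)) =
        (\<Sum>j\<in>J. profile (k - 1) \<psi> (card (zero_set X (J - {j}) \<omega>)))"
      unfolding e Z_def by simp
  qed
  also have "\<dots> = real (card {1..n} + 1 - k) *
      (\<Sum>L | L \<subseteq> {1..n} \<and> card L = k - 1. profile (k - 1) \<psi> (card (zero_set X L \<omega>)))"
    using k by (intro sum_subsets_remove) auto
  finally show ?thesis using U_statistic_zero_set[OF sym(2) \<omega>, of n] by simp
qed

text \<open>Every configuration has positive probability, so a U-statistic of norm zero vanishes at
  every set of zeros, and its kernel vanishes by the triangular system.\<close>

lemma profile_eq_0_if_U_statistic_norm_0: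
  assumes sym: "symmetric_kernel k \<eta>" and k: "k \<le> n" and a: "a \<le> k"
    and zero: "(\<integral>\<omega>. U_statistic X n k \<eta> \<omega> * U_statistic X n k \<eta> \<omega> \<partial>M) = 0"
  shows "profile k \<eta> a = 0"
proof -
  define g where "g S = (\<Sum>J | J \<subseteq> {1..n} \<and> card J = k. profile k \<eta> (card (J \<inter> S)))" for S
  have "U_statistic X n k \<eta> \<omega> = g (zero_set X {1..n} \<omega>)" if "\<omega> \<in> space M" for \<omega>
    unfolding g_def U_statistic_zero_set[OF sym that]
    by (intro sum.cong refl) (auto simp: zero_set_subset)
  then have "(\<integral>\<omega>. g (zero_set X {1..n} \<omega>) * g (zero_set X {1..n} \<omega>) \<partial>M) = 0"
    using zero by (simp cong: Bochner_Integration.integral_cong)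
  then have "(\<Sum>S\<in>Pow {1..n}. f (card S) (card {1..n} - card S) * (g S * g S)) = 0"
    by (subst expectation_zero_set[where g = "\<lambda>S. g S * g S", symmetric]) auto
  then have "\<forall>S\<in>Pow {1..n}. f (card S) (card {1..n} - card S) * (g S * g S) = 0"
    by (subst (asm) sum_nonneg_eq_0_iff) (simp_all add: mult_nonneg_nonneg less_imp_le[OF f_pos])
  then have "g S = 0" if "S \<subseteq> {1..n}" for S
    using that f_pos[of "card S" "card {1..n} - card S"] by (metis PowI less_irrefl mult_eq_0_iff)
  then show ?thesis
    using sum_subsets_card_Int_inject[of "{1..n}" k a "profile k \<eta>"] k a by (simp add: g_def)
qed

lemma U_statistic_diff_scale:
  "U_statistic X n k (\<lambda>xs. \<phi> xs - c * \<phi>' xs) \<omega> = U_statistic X n k \<phi> \<omega> - c * U_statistic X n k \<phi>' \<omega>"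
  by (simp add: U_statistic_def sum_subtractf sum_distrib_left)

lemma U_statistic_integrable:
  assumes "symmetric_kernel k \<phi>" "symmetric_kernel l \<psi>"
  shows "integrable M (\<lambda>\<omega>. U_statistic X n k \<phi> \<omega> * U_statistic X n l \<psi> \<omega>)"
proof -
  define g where "g k \<phi> S = (\<Sum>J | J \<subseteq> {1..n} \<and> card J = k. profile k \<phi> (card (J \<inter> S)))" for k \<phi> S
  have eq: "U_statistic X n k \<phi> \<omega> = g k \<phi> (zero_set X {1..n} \<omega>)"
    if "\<omega> \<in> space M" "symmetric_kernel k \<phi>" for \<omega> k \<phi>
    unfolding g_def U_statistic_zero_set[OF that(2,1)]
    by (intro sum.cong refl) (auto simp: zero_set_subset)
  have "integrable M (\<lambda>\<omega>. g k \<phi> (zero_set X {1..n} \<omega>) * g l \<psi> (zero_set X {1..n} \<omega>))"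
    by (rule integrable_zero_set[where g = "\<lambda>S. g k \<phi> S * g l \<psi> S"]) auto
  then show ?thesis
    using eq assms by (simp cong: Bochner_Integration.integrable_cong)
qed

subsection \<open>The orthogonality relations\<close>

text \<open>\<open>SU\<^sub>k\<close> is spanned by \<open>SU\<^sub>k\<^sub>-\<^sub>1\<close> and the U-statistic of the degenerate kernel, so
  orthogonality of the latter to \<open>SU\<^sub>k\<^sub>-\<^sub>1\<close> identifies \<open>SH\<^sub>k\<close>.\<close>

lemma U_statistic_in_SH_iff_degenerate:
  assumes k: "1 \<le> k" "k \<le> n" and sym: "symmetric_kernel k \<phi>"
    and zero: "\<And>u h. 1 \<le> u \<Longrightarrow> u \<le> k \<Longrightarrow> pairing k u (degenerate_kernel k) h = 0"
  shows "U_statistic X n k \<phi> \<in> SH M X n k \<longleftrightarrow> (\<exists>c. \<forall>a\<le>k. profile k \<phi> a = c * degenerate_kernel k a)"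
proof
  \<comment> \<open>Every pair of index sets satisfies \<open>1 \<le> card (J - L) \<le> k\<close>,
    so each term in the expansion of the inner product is zero by hypothesis.\<close>
  have *: "(\<integral>\<omega>. U_statistic X n k \<phi>' \<omega> * U_statistic X n (k - 1) \<psi> \<omega> \<partial>M) = 0"
    if "symmetric_kernel k \<phi>'" "symmetric_kernel (k - 1) \<psi>"
      and c: "\<forall>a\<le>k. profile k \<phi>' a = c * degenerate_kernel k a" for \<phi>' \<psi> c
  proof -
    have "pairing k (card (J - L)) (profile k \<phi>') (profile (k - 1) \<psi>) = 0"
      if "J \<subseteq> {1..n} \<and> card J = k" "L \<subseteq> {1..n} \<and> card L = k - 1" for J L
    proof -
      have "finite J" "finite L" using that by (auto intro: finite_subset)
      with that k have u: "1 \<le> card (J - L)" "card (J - L) \<le> k"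
        using card_Diff_bounds[of L J k] by auto
      have "pairing k (card (J - L)) (profile k \<phi>') (profile (k - 1) \<psi>) =
          pairing k (card (J - L)) (\<lambda>a. c * degenerate_kernel k a) (profile (k - 1) \<psi>)"
        using c u by (intro pairing_cong) auto
      then show ?thesis using zero u by (simp add: pairing_scale_left)
    qed
    then show ?thesis
      using that k by (subst expectation_U_statistics) (auto intro!: sum.neutral)
  qed
  {
    assume "\<exists>c. \<forall>a\<le>k. profile k \<phi> a = c * degenerate_kernel k a"
    then show "U_statistic X n k \<phi> \<in> SH M X n k"
      using * sym by (auto simp: U_statistic_in_SH_iff)
  next
    assume SH: "U_statistic X n k \<phi> \<in> SH M X n k"
    define \<delta> where "\<delta> = (\<lambda>xs :: nat list. degenerate_kernel k (count_list xs 0))"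
    have sym_\<delta>: "symmetric_kernel k \<delta>" unfolding \<delta>_def by (rule symmetric_kernel_count)
    have prof_\<delta>: "profile k \<delta> a = degenerate_kernel k a" if "a \<le> k" for a
      unfolding \<delta>_def using that by (rule profile_count)
    \<comment> \<open>By \<open>solve_lift\<close>, kernels annihilated by this functional are lifts
      of kernels of \<open>k - 1\<close> variables. On the degenerate kernel the signs cancel,
      leaving a sum of positive terms.\<close>
    define \<Lambda> where "\<Lambda> g = (\<Sum>a\<le>k. (- 1) ^ a * real (k choose a) * g a)" for g :: "nat \<Rightarrow> real"
    have \<Lambda>_pos: "\<Lambda> (degenerate_kernel k) > 0"
    proof -
      have "\<Lambda> (degenerate_kernel k) = (\<Sum>a\<le>k. real (k choose a) / f a (k - a))"
        unfolding \<Lambda>_def degenerate_kernel_def by (intro sum.cong refl) (simp flip: power_mult_distrib)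
      also have "\<dots> > 0"
        using f_pos by (intro sum_pos) (auto intro!: divide_pos_pos)
      finally show ?thesis .
    qed
    \<comment> \<open>With this constant, subtracting \<open>c\<close> times the degenerate kernel
      leaves a kernel in the null space of \<open>\<Lambda>\<close>.\<close>
    define c where "c = \<Lambda> (profile k \<phi>) / \<Lambda> (degenerate_kernel k)"
    define \<eta> where "\<eta> = (\<lambda>xs. \<phi> xs - c * \<delta> xs)"
    have sym_\<eta>: "symmetric_kernel k \<eta>"
      using sym sym_\<delta> by (simp add: \<eta>_def symmetric_kernel_def)
    have prof_\<eta>: "profile k \<eta> a = profile k \<phi> a - c * degenerate_kernel k a" if "a \<le> k" for a
      using prof_\<delta>[OF that] by (simp add: \<eta>_def profile_def)
    have "\<Lambda> (profile k \<eta>) = \<Lambda> (profile k \<phi>) - c * \<Lambda> (degenerate_kernel k)"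
      unfolding \<Lambda>_def sum_distrib_left sum_subtractf[symmetric]
      by (intro sum.cong refl) (simp add: prof_\<eta> algebra_simps)
    then have "(\<Sum>a\<le>k. (- 1) ^ a * real (k choose a) * profile k \<eta> a) = 0"
      using \<Lambda>_pos by (simp add: c_def flip: \<Lambda>_def)
    from solve_lift[OF k(1) this] obtain h where
      h: "\<And>a. a \<le> k \<Longrightarrow> profile k \<eta> a = real (k - a) * h a + real a * h (a - 1)" by blast
    define \<psi> where "\<psi> = (\<lambda>xs :: nat list. h (count_list xs 0))"
    have sym_\<psi>: "symmetric_kernel (k - 1) \<psi>" unfolding \<psi>_def by (rule symmetric_kernel_count)
    have prof_\<psi>: "profile (k - 1) \<psi> a = h a" if "a \<le> k - 1" for a
      unfolding \<psi>_def using that by (rule profile_count)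
    \<comment> \<open>At \<open>a = k\<close> the value \<open>h k\<close> is multiplied by zero, so
      it is enough that \<open>\<psi>\<close> reproduces \<open>h\<close> up to
      \<open>k - 1\<close>.\<close>
    have lift: "profile k \<eta> a = real (k - a) * profile (k - 1) \<psi> a + real a * profile (k - 1) \<psi> (a - 1)"
      if "a \<le> k" for a
      using h[OF that] that prof_\<psi>[of a] prof_\<psi>[of "a - 1"] by (cases "a = k") auto
    \<comment> \<open>The U-statistic of \<open>\<eta>\<close> is a multiple of that of
      \<open>\<psi>\<close>, hence lies in \<open>SU X n (k - 1)\<close>, and is also orthogonal to
      that space. Its norm is therefore zero.\<close>
    have "(\<integral>\<omega>. U_statistic X n k \<eta> \<omega> * U_statistic X n k \<eta> \<omega> \<partial>M) =
      (\<integral>\<omega>. real (n + 1 - k) * (U_statistic X n k \<phi> \<omega> * U_statistic X n (k - 1) \<psi> \<omega> -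
        c * (U_statistic X n k \<delta> \<omega> * U_statistic X n (k - 1) \<psi> \<omega>)) \<partial>M)"
    proof (intro Bochner_Integration.integral_cong refl)
      fix \<omega> assume "\<omega> \<in> space M"
      from U_statistic_lift[OF k sym_\<eta> sym_\<psi> lift this]
      have "U_statistic X n k \<eta> \<omega> * U_statistic X n k \<eta> \<omega> =
          (U_statistic X n k \<phi> \<omega> - c * U_statistic X n k \<delta> \<omega>) * (real (n + 1 - k) * U_statistic X n (k - 1) \<psi> \<omega>)"
        by (simp add: \<eta>_def U_statistic_diff_scale)
      then show "U_statistic X n k \<eta> \<omega> * U_statistic X n k \<eta> \<omega> =
        real (n + 1 - k) * (U_statistic X n k \<phi> \<omega> * U_statistic X n (k - 1) \<psi> \<omega> -
          c * (U_statistic X n k \<delta> \<omega> * U_statistic X n (k - 1) \<psi> \<omega>))"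
        by (simp only: algebra_simps)
    qed
    also have "\<dots> = real (n + 1 - k) * ((\<integral>\<omega>. U_statistic X n k \<phi> \<omega> * U_statistic X n (k - 1) \<psi> \<omega> \<partial>M) -
        c * (\<integral>\<omega>. U_statistic X n k \<delta> \<omega> * U_statistic X n (k - 1) \<psi> \<omega> \<partial>M))"
      using U_statistic_integrable[OF sym sym_\<psi>] U_statistic_integrable[OF sym_\<delta> sym_\<psi>] by simp
    also have "\<dots> = 0"
      using SH sym sym_\<psi> *[OF sym_\<delta> sym_\<psi>, of 1] prof_\<delta> by (simp add: U_statistic_in_SH_iff)
    finally have "profile k \<eta> a = 0" if "a \<le> k" for a
      using profile_eq_0_if_U_statistic_norm_0[OF sym_\<eta> k(2) that] by simp
    then show "\<exists>c. \<forall>a\<le>k. profile k \<phi> a = c * degenerate_kernel k a"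
      using prof_\<eta> by (intro exI[of _ c]) simp
  }
qed

text \<open>With \<open>n = k + u - 1\<close> the difference \<open>J - L\<close> has at most \<open>u\<close> elements, so the orthogonality
  relations for growing \<open>n\<close> form a triangular system for the pairings.\<close>

lemma pairing_eq_0_of_SH:
  assumes k: "2 \<le> k" and u: "1 \<le> u" "u \<le> k"
    and SH: "\<And>n. k \<le> n \<Longrightarrow>
      U_statistic X n k (\<lambda>xs. degenerate_kernel k (count_list xs 0)) \<in> SH M X n k"
  shows "pairing k u (degenerate_kernel k) h = 0"
  using u
proof (induction u rule: less_induct)
  case (less u)
  define n where "n = k + u - 1"
  define \<delta> where "\<delta> = (\<lambda>xs :: nat list. degenerate_kernel k (count_list xs 0))"
  define \<psi> where "\<psi> = (\<lambda>xs :: nat list. h (count_list xs 0))"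
  define P where "P = pairing k u (degenerate_kernel k) h"
  define \<J> where "\<J> = {J. J \<subseteq> {1..n} \<and> card J = k}"
  define \<L> where "\<L> = {L. L \<subseteq> {1..n} \<and> card L = k - 1}"
  have fin: "finite \<J>" "finite \<L>" by (auto simp: \<J>_def \<L>_def)
  have sym: "symmetric_kernel k \<delta>" "symmetric_kernel (k - 1) \<psi>"
    unfolding \<delta>_def \<psi>_def by (rule symmetric_kernel_count)+
  have "U_statistic X n k \<delta> \<in> SH M X n k"
    unfolding \<delta>_def using less.prems by (intro SH) (simp add: n_def)
  then have "0 = (\<Sum>J\<in>\<J>. \<Sum>L\<in>\<L>. pairing k (card (J - L)) (profile k \<delta>) (profile (k - 1) \<psi>))"
    using sym k expectation_U_statistics[OF sym, of n]
    by (simp add: U_statistic_in_SH_iff \<J>_def \<L>_def)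
  \<comment> \<open>The complement of \<open>L\<close> has \<open>n - (k - 1) = u\<close> elements,
    so larger differences do not occur; smaller ones contribute zero by induction.\<close>
  also have "\<dots> = (\<Sum>J\<in>\<J>. \<Sum>L\<in>\<L>. (if card (J - L) = u then 1 else 0) * P)"
  proof (intro sum.cong refl)
    fix J L assume JL: "J \<in> \<J>" "L \<in> \<L>"
    then have f: "finite J" "finite L" by (auto simp: \<J>_def \<L>_def intro: finite_subset)
    have b: "1 \<le> card (J - L)" "card (J - L) \<le> k"
      using JL f k card_Diff_bounds[of L J k] by (auto simp: \<J>_def \<L>_def)
    have "card (J - L) \<le> card ({1..n} - L)"
      using JL by (intro card_mono) (auto simp: \<J>_def)
    also have "\<dots> = u"
      using JL f k less.prems by (auto simp: \<L>_def card_Diff_subset n_def)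
    finally have le: "card (J - L) \<le> u" .
    have "pairing k (card (J - L)) (profile k \<delta>) (profile (k - 1) \<psi>) =
        pairing k (card (J - L)) (degenerate_kernel k) h"
      using b by (intro pairing_cong) (auto simp: \<delta>_def \<psi>_def profile_count)
    also have "\<dots> = (if card (J - L) = u then 1 else 0) * P"
      using less.IH[of "card (J - L)"] b le by (auto simp: P_def)
    finally show "pairing k (card (J - L)) (profile k \<delta>) (profile (k - 1) \<psi>) =
        (if card (J - L) = u then 1 else 0) * P" .
  qed
  also have "\<dots> = (\<Sum>J\<in>\<J>. \<Sum>L\<in>\<L>. if card (J - L) = u then 1 else 0) * P"
    by (simp add: sum_distrib_right)
  finally have 0: "(\<Sum>J\<in>\<J>. \<Sum>L\<in>\<L>. if card (J - L) = u then 1 else 0) * P = 0" by simp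
  \<comment> \<open>One pair attaining the difference \<open>u\<close> makes the number of such
    pairs positive, so \<open>P\<close> must vanish.\<close>
  have mem: "{1..k} \<in> \<J>" "{u + 1..n} \<in> \<L>" "card ({1..k} - {u + 1..n}) = u"
  proof -
    have "{1..k} - {u + 1..n} = {1..u}" using less.prems by (auto simp: n_def)
    then show "card ({1..k} - {u + 1..n}) = u" by simp
  qed (use less.prems in \<open>auto simp: \<J>_def \<L>_def n_def\<close>)
  have pos: "(0 :: real) < (\<Sum>L\<in>\<L>. if card ({1..k} - L) = u then 1 else 0)"
    using mem fin by (intro sum_pos2[of _ "{u + 1..n}"]) auto
  have "(0 :: real) < (\<Sum>J\<in>\<J>. \<Sum>L\<in>\<L>. if card (J - L) = u then 1 else 0)"
    using pos by (rule sum_pos2[OF fin(1) mem(1)]) (auto intro: sum_nonneg)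
  then show ?case using 0 by (simp add: P_def)
qed

text \<open>For necessity, the degenerate kernel has vanishing conditional expectation, so its
  U-statistic lies in \<open>SH\<close> for every \<open>n \<ge> k\<close> and the triangular system
  applies. For sufficiency, both sides of the defining equivalence describe the multiples of the
  degenerate kernel.\<close>

lemma Hoeffding_decomposable_iff_pairing:
  "Hoeffding_decomposable M X \<longleftrightarrow>
    (\<forall>k\<ge>2. \<forall>u\<in>{2..k}. \<forall>h. pairing k u (degenerate_kernel k) h = 0)"
proof
  assume HD: "Hoeffding_decomposable M X"
  show "\<forall>k\<ge>2. \<forall>u\<in>{2..k}. \<forall>h. pairing k u (degenerate_kernel k) h = 0"
  proof (intro allI impI ballI)
    fix k u :: nat and h assume k: "2 \<le> k" "u \<in> {2..k}"
    show "pairing k u (degenerate_kernel k) h = 0"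
    proof (rule pairing_eq_0_of_SH)
      fix n assume n: "k \<le> n"
      have "\<exists>c. \<forall>a\<le>k. profile k (\<lambda>xs. degenerate_kernel k (count_list xs 0)) a = c * degenerate_kernel k a"
        by (rule exI[of _ 1]) (simp add: profile_count)
      then show "U_statistic X n k (\<lambda>xs. degenerate_kernel k (count_list xs 0)) \<in> SH M X n k"
        using HD k n symmetric_kernel_count[of k "degenerate_kernel k"]
          cond_exp_kernel_eq_0_iff[OF _ symmetric_kernel_count[of k "degenerate_kernel k"]]
        unfolding Hoeffding_decomposable_def by auto
    qed (use k in auto)
  qed
next
  assume zero: "\<forall>k\<ge>2. \<forall>u\<in>{2..k}. \<forall>h. pairing k u (degenerate_kernel k) h = 0"
  \<comment> \<open>The case \<open>u = 1\<close> is automatic; it also covers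
    \<open>k = 1\<close>.\<close>
  have "pairing k u (degenerate_kernel k) h = 0" if "1 \<le> u" "u \<le> k" for k u h
    using that zero pairing_degenerate_1[of k h] by (cases "u = 1") auto
  note zero' = this
  show "Hoeffding_decomposable M X"
    unfolding Hoeffding_decomposable_def
  proof (intro allI impI ballI)
    fix n k \<phi> assume "k \<in> {1..n}" and sym: "symmetric_kernel k \<phi>"
    then have k: "1 \<le> k" "k \<le> n" by auto
    show "U_statistic X n k \<phi> \<in> SH M X n k \<longleftrightarrow>
        (AE \<omega> in M. real_cond_exp M (sigma_of_vector M X {2..k}) (\<lambda>\<omega>. \<phi> (subvector X {1..k} \<omega>)) \<omega> = 0)"
      unfolding cond_exp_kernel_eq_0_iff[OF k(1) sym]
      using k sym zero' by (rule U_statistic_in_SH_iff_degenerate)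
  qed
qed

subsection \<open>Conditional probabilities\<close>

lemma prob_count_zeros:
  assumes "a \<le> n"
  shows "prob {\<omega> \<in> space M. card (zero_set X {1..n} \<omega>) = a} = real (n choose a) * f a (n - a)"
proof -
  have "prob {\<omega> \<in> space M. card (zero_set X {1..n} \<omega>) = a} =
      (\<Sum>S\<in>Pow {1..n}. f (card S) (card {1..n} - card S) * (if card S = a then 1 else 0))"
    by (rule prob_zero_set_event) auto
  also have "\<dots> = (\<Sum>s\<le>n. real (n choose s) * (f s (n - s) * (if s = a then 1 else 0)))"
    by (subst sum_Pow_card[where g = "\<lambda>s. f s (card {1..n} - s) * (if s = a then 1 else 0)"]) auto
  also have "\<dots> = real (n choose a) * f a (n - a)"
    using assms by (simp add: if_distrib sum.delta' cong: if_cong)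
  finally show ?thesis .
qed

lemma prob_count_zeros2:
  assumes "a \<le> n" "a \<le> b" "b \<le> a + v"
  shows "prob {\<omega> \<in> space M. card (zero_set X {1..n + v} \<omega>) = b \<and> card (zero_set X {1..n} \<omega>) = a} =
    real (n choose a) * (real (v choose (b - a)) * f b (n + v - b))"
proof -
  have un: "{1..n + v} = {1..n} \<union> {n + 1..n + v}" by auto
  have sub: "{1..n} \<subseteq> {1..n + v}" by auto
  have "prob {\<omega> \<in> space M. card (zero_set X {1..n + v} \<omega>) = b \<and> card (zero_set X {1..n} \<omega>) = a} =
      (\<Sum>S\<in>Pow {1..n + v}. f (card S) (card {1..n + v} - card S) *
        (if card S = b \<and> card ({1..n} \<inter> S) = a then 1 else 0))"
    unfolding zero_set_subset[OF sub] by (rule prob_zero_set_event) auto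
  also have "\<dots> = (\<Sum>A\<in>Pow {1..n}. \<Sum>B\<in>Pow {n + 1..n + v}.
      f (card A + card B) (n + v - (card A + card B)) * (if card A + card B = b \<and> card A = a then 1 else 0))"
  proof -
    have "f (card (A \<union> B)) (card {1..n + v} - card (A \<union> B)) *
          (if card (A \<union> B) = b \<and> card ({1..n} \<inter> (A \<union> B)) = a then 1 else 0) =
        f (card A + card B) (n + v - (card A + card B)) * (if card A + card B = b \<and> card A = a then 1 else 0)"
      if "A \<in> Pow {1..n}" "B \<in> Pow {n + 1..n + v}" for A B
    proof -
      have "finite A" "finite B" using that by (auto intro: finite_subset)
      moreover have disj: "{1..n} \<inter> {n + 1..n + v} = {}" by auto
      moreover have "A \<inter> B = {}" "{1..n} \<inter> (A \<union> B) = A" using that disj by blast+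
      ultimately show ?thesis by (simp add: card_Un_disjoint)
    qed
    then show ?thesis
      unfolding un by (subst sum_Pow_Un) (auto intro!: sum.cong simp flip: un)
  qed
  also have "\<dots> = (\<Sum>s\<le>n. real (n choose s) * (\<Sum>t\<le>v. real (v choose t) *
      (f (s + t) (n + v - (s + t)) * (if s + t = b \<and> s = a then 1 else 0))))"
    by (subst sum_Pow_card[where A = "{n + 1..n + v}" and g = "\<lambda>t. f (_ + t) (n + v - (_ + t)) * (if _ + t = b \<and> _ then 1 else 0)"], simp)
      (subst sum_Pow_card[where g = "\<lambda>s. \<Sum>t\<le>card {n + 1..n + v}. real (card {n + 1..n + v} choose t) *
      (f (s + t) (n + v - (s + t)) * (if s + t = b \<and> s = a then 1 else 0))"], auto)
  also have "\<dots> = (\<Sum>s\<le>n. if s = a then real (n choose a) * (\<Sum>t\<le>v. real (v choose t) *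
      (f (a + t) (n + v - (a + t)) * (if a + t = b then 1 else 0))) else 0)"
    by (intro sum.cong refl) auto
  also have "\<dots> = real (n choose a) * (\<Sum>t\<le>v. real (v choose t) *
      (f (a + t) (n + v - (a + t)) * (if a + t = b then 1 else 0)))"
    using assms by (subst sum.delta) auto
  also have "\<dots> = real (n choose a) * (\<Sum>t\<le>v. if t = b - a then real (v choose (b - a)) * f b (n + v - b) else 0)"
    using assms by (intro arg_cong[of _ _ "(*) _"] sum.cong refl) auto
  also have "\<dots> = real (n choose a) * (real (v choose (b - a)) * f b (n + v - b))"
    using assms by (subst sum.delta) auto
  finally show ?thesis .
qed

lemma zeros_cond_prob_eq:
  assumes "a \<le> n" "a \<le> b" "b \<le> a + v"
  shows "zeros_cond_prob M X (n + v) n b a = real (v choose (b - a)) * f b (n + v - b) / f a (n - a)"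
  unfolding zeros_cond_prob_def cond_prob_def
  using assms prob_count_zeros[of a n] prob_count_zeros2[of a n b v]
  by (simp add: count_list_subvector)

text \<open>In the pairing, \<open>m\<close> counts the zeros in \<open>J - L\<close> and
  \<open>k\<close> those in \<open>J \<inter> L\<close>; the point mass at \<open>z\<close> forces
  \<open>z - k\<close> zeros in \<open>L - J\<close>. The signs and the denominators of the
  conditional probabilities form the degenerate kernel at \<open>m + k\<close>.\<close>

lemma zeros_cond_prob_sum_eq_pairing:
  assumes "2 \<le> u" "u \<le> n" "z \<le> n - 1"
  shows "(\<Sum>k = max 0 (z - (u - 1))..min z (n - u).
      (- 1) ^ k * real ((n - u) choose k) *
      (\<Sum>m = 0..u. (- 1) ^ m * real (u choose m) * zeros_cond_prob M X (n + u - 1) n (m + z) (m + k))) =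
    pairing n u (degenerate_kernel n) (\<lambda>a. if a = z then 1 else 0)"
proof -
  define w where "w m k = real (u choose m) * (real ((n - u) choose k) *
    (real ((u - 1) choose (z - k)) * (f (m + z) (n + u - 1 - (m + z)) * degenerate_kernel n (m + k))))" for m k
  \<comment> \<open>These are the \<open>k \<le> n - u\<close> for which \<open>z - k\<close> zeros
    fit into a block of \<open>u - 1\<close> coordinates.\<close>
  define K where "K = {max 0 (z - (u - 1))..min z (n - u)}"
  have K: "K \<subseteq> {..n - u}" by (auto simp: K_def)
  have "(- 1) ^ k * real ((n - u) choose k) * ((- 1) ^ m * real (u choose m) *
      zeros_cond_prob M X (n + u - 1) n (m + z) (m + k)) = w m k"
    if "k \<in> K" "m \<le> u" for k m
  proof -
    have "n + u - 1 = n + (u - 1)" using assms by simp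
    moreover have "zeros_cond_prob M X (n + (u - 1)) n (m + z) (m + k) =
      real ((u - 1) choose (m + z - (m + k))) * f (m + z) (n + (u - 1) - (m + z)) / f (m + k) (n - (m + k))"
      using that assms by (intro zeros_cond_prob_eq) (auto simp: K_def)
    ultimately show ?thesis
      by (simp add: w_def degenerate_kernel_def power_add)
  qed
  then have "(\<Sum>k\<in>K. (- 1) ^ k * real ((n - u) choose k) *
      (\<Sum>m = 0..u. (- 1) ^ m * real (u choose m) * zeros_cond_prob M X (n + u - 1) n (m + z) (m + k))) =
      (\<Sum>k\<in>K. \<Sum>m\<le>u. w m k)"
    unfolding sum_distrib_left atLeast0AtMost by (intro sum.cong refl) auto
  also have "\<dots> = (\<Sum>m\<le>u. \<Sum>k\<in>K. w m k)" by (rule sum.swap)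
  also have "\<dots> = (\<Sum>m\<le>u. \<Sum>k\<le>n - u. if k \<in> K then w m k else 0)"
    using K by (simp add: Int_absorb1 flip: sum.inter_restrict)
  also have "\<dots> = pairing n u (degenerate_kernel n) (\<lambda>a. if a = z then 1 else 0)"
    unfolding pairing_def sum_distrib_left[of "real (u choose _)"]
  proof (intro sum.cong refl)
    fix m k assume mk: "m \<in> {..u}" "k \<in> {..n - u}"
    have "(\<Sum>c\<le>u - 1. real ((u - 1) choose c) * (f (m + k + c) (n + u - 1 - (m + k + c)) *
        (degenerate_kernel n (m + k) * (if k + c = z then 1 else 0)))) =
      (if k \<in> K then real ((u - 1) choose (z - k)) * (f (m + z) (n + u - 1 - (m + z)) * degenerate_kernel n (m + k)) else 0)"
    proof (cases "k \<in> K")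
      case True
      have "(\<Sum>c\<le>u - 1. real ((u - 1) choose c) * (f (m + k + c) (n + u - 1 - (m + k + c)) *
          (degenerate_kernel n (m + k) * (if k + c = z then 1 else 0)))) =
        (\<Sum>c\<le>u - 1. if c = z - k then real ((u - 1) choose (z - k)) * (f (m + z) (n + u - 1 - (m + z)) * degenerate_kernel n (m + k)) else 0)"
        using True by (intro sum.cong refl) (auto simp: K_def)
      then show ?thesis using True by (auto simp: sum.delta K_def)
    next
      case False
      then show ?thesis using mk by (auto simp: K_def intro!: sum.neutral)
    qed
    then show "(if k \<in> K then w m k else 0) = real (u choose m) * (real ((n - u) choose k) *
        (\<Sum>c\<le>u - 1. real ((u - 1) choose c) * (f (m + k + c) (n + u - 1 - (m + k + c)) *
        (degenerate_kernel n (m + k) * (if k + c = z then 1 else 0)))))"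
      by (simp add: w_def)
  qed
  finally show ?thesis unfolding K_def .
qed

lemma Hoeffding_decomposable_iff_zeros_cond_prob:
  "Hoeffding_decomposable M X \<longleftrightarrow>
    (\<forall>n\<ge>2. \<forall>u\<in>{2..n}. \<forall>z\<in>{0..n - 1}.
       0 = (\<Sum>k = max 0 (z - (u - 1))..min z (n - u).
              (- 1) ^ k * real ((n - u) choose k) *
              (\<Sum>m = 0..u. (- 1) ^ m * real (u choose m) *
                 zeros_cond_prob M X (n + u - 1) n (m + z) (m + k))))"
  unfolding Hoeffding_decomposable_iff_pairing
proof (intro all_cong ball_cong refl)
  fix n u :: nat assume u: "n \<ge> 2" "u \<in> {2..n}"
  have "(\<forall>h. pairing n u (degenerate_kernel n) h = 0) \<longleftrightarrow>
      (\<forall>z\<in>{0..n - 1}. pairing n u (degenerate_kernel n) (\<lambda>a. if a = z then 1 else 0) = 0)"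
    using u by (subst pairing_eq_0_iff) auto
  also have "\<dots> \<longleftrightarrow> (\<forall>z\<in>{0..n - 1}.
       0 = (\<Sum>k = max 0 (z - (u - 1))..min z (n - u).
              (- 1) ^ k * real ((n - u) choose k) *
              (\<Sum>m = 0..u. (- 1) ^ m * real (u choose m) *
                 zeros_cond_prob M X (n + u - 1) n (m + z) (m + k))))"
    using u zeros_cond_prob_sum_eq_pairing[of u n] by (intro ball_cong refl) auto
  finally show "(\<forall>h. pairing n u (degenerate_kernel n) h = 0) \<longleftrightarrow> (\<forall>z\<in>{0..n - 1}.
       0 = (\<Sum>k = max 0 (z - (u - 1))..min z (n - u).
              (- 1) ^ k * real ((n - u) choose k) *
              (\<Sum>m = 0..u. (- 1) ^ m * real (u choose m) *
                 zeros_cond_prob M X (n + u - 1) n (m + z) (m + k))))" .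
qed

end

section \<open>The mixing measure of a non-deterministic sequence\<close>

text \<open>Here \<open>\<theta>\<close> is the probability of a one. The recursion is
  \<open>\<theta> + (1 - \<theta>) = 1\<close> under the integral, and positivity comes from a
  support point strictly between 0 and 1.\<close>

lemma de_finetti_positive_mixture:
  fixes M :: "'a measure" and X :: "nat \<Rightarrow> 'a \<Rightarrow> nat"
  assumes "prob_space M" and X: "\<And>n. n \<ge> 1 \<Longrightarrow> X n \<in> M \<rightarrow>\<^sub>M count_space {0, 1}"
    and \<gamma>: "de_finetti_measure M X \<gamma>" and supp: "\<not> measure_support \<gamma> \<subseteq> {0} \<union> {1}"
  shows "positive_mixture M X (\<lambda>a b. \<integral>\<theta>. \<theta> ^ b * (1 - \<theta>) ^ a \<partial>\<gamma>)"
proof -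
  interpret M: prob_space M by fact
  interpret \<gamma>: prob_space \<gamma> using \<gamma> by (simp add: de_finetti_measure_def)
  have sets: "sets \<gamma> = sets (restrict_space borel {0..1})" using \<gamma> by (simp add: de_finetti_measure_def)
  then have space: "space \<gamma> = {0..1}"
    using sets_eq_imp_space_eq[OF sets] by (simp add: space_restrict_space)
  have meas: "(\<lambda>\<theta>. \<theta> ^ b * (1 - \<theta>) ^ a) \<in> borel_measurable \<gamma>" for a b :: nat
  proof -
    have "(\<lambda>\<theta>::real. \<theta> ^ b * (1 - \<theta>) ^ a) \<in> borel_measurable (restrict_space borel {0..1})"
      by (rule measurable_restrict_space1) measurable
    then show ?thesis using measurable_cong_sets[OF sets refl] by blast
  qed
  have int: "integrable \<gamma> (\<lambda>\<theta>. \<theta> ^ b * (1 - \<theta>) ^ a)" for a b :: nat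
  proof (rule \<gamma>.integrable_const_bound[where B = 1])
    show "AE \<theta> in \<gamma>. norm (\<theta> ^ b * (1 - \<theta>) ^ a) \<le> 1"
      by (intro AE_I2) (auto simp: space abs_mult intro!: mult_le_one power_le_one)
  qed (rule meas)
  obtain x where x: "x \<in> measure_support \<gamma>" "x \<noteq> 0" "x \<noteq> 1" using supp by auto
  then have x01: "0 < x" "x < 1" by (auto simp: measure_support_def space)
  \<comment> \<open>A neighbourhood of \<open>x\<close> bounded away from 0 and 1: on it
    \<open>\<theta>\<close> exceeds \<open>x / 2\<close> and \<open>1 - \<theta>\<close> exceeds
    \<open>(1 - x) / 2\<close>, so the integrand is at least the constant \<open>c\<close> used
    below.\<close>
  define U where "U = {x / 2<..<(1 + x) / 2}"
  have U: "measure \<gamma> (U \<inter> space \<gamma>) > 0"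
    using x x01 by (auto simp: measure_support_def U_def)
  have Usub: "U \<inter> space \<gamma> = U" using x01 by (auto simp: U_def space)
  have U_sets: "U \<in> sets \<gamma>"
    unfolding sets using Usub space by (auto simp: sets_restrict_space U_def image_iff intro!: bexI[of _ U])
  show ?thesis
  proof unfold_locales
    show "X n \<in> M \<rightarrow>\<^sub>M count_space {0, 1}" if "n \<ge> 1" for n using X that .
  next
    fix a b :: nat
    define c where "c = (x / 2) ^ b * ((1 - x) / 2) ^ a"
    have "0 < c * measure \<gamma> U" using x01 U by (simp add: c_def Usub)
    also have "\<dots> = (\<integral>\<theta>. c * indicator U \<theta> \<partial>\<gamma>)" using Usub by simp
    also have "\<dots> \<le> (\<integral>\<theta>. \<theta> ^ b * (1 - \<theta>) ^ a \<partial>\<gamma>)"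
    proof (rule integral_mono)
      show "integrable \<gamma> (\<lambda>\<theta>. c * indicator U \<theta>)"
        using U_sets by (intro integrable_mult_right integrable_real_indicator) (auto simp flip: less_top)
      fix \<theta> assume \<theta>: "\<theta> \<in> space \<gamma>"
      show "c * indicator U \<theta> \<le> \<theta> ^ b * (1 - \<theta>) ^ a"
      proof (cases "\<theta> \<in> U")
        case True
        then show ?thesis using x01 by (auto simp: c_def U_def intro!: mult_mono power_mono)
      next
        case False
        then show ?thesis using \<theta> by (simp add: space)
      qed
    qed (rule int)
    finally show "0 < (\<integral>\<theta>. \<theta> ^ b * (1 - \<theta>) ^ a \<partial>\<gamma>)" .
    show "(\<integral>\<theta>. \<theta> ^ b * (1 - \<theta>) ^ a \<partial>\<gamma>) =
        (\<integral>\<theta>. \<theta> ^ b * (1 - \<theta>) ^ Suc a \<partial>\<gamma>) + (\<integral>\<theta>. \<theta> ^ Suc b * (1 - \<theta>) ^ a \<partial>\<gamma>)"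
      unfolding Bochner_Integration.integral_add[OF int int, symmetric]
      by (intro Bochner_Integration.integral_cong refl) (simp add: algebra_simps)
  next
    fix n :: nat and S assume n: "n \<ge> 1" and S: "S \<subseteq> {1..n}"
    have bin: "X i \<omega> \<in> {0, 1}" if "i \<in> {1..n}" "\<omega> \<in> space M" for i \<omega>
      using measurable_space[OF X that(2)] that(1) by simp
    have cS: "card S \<le> n" using card_mono[OF _ S] by simp
    have "{\<omega> \<in> space M. zero_set X {1..n} \<omega> = S} =
        {\<omega> \<in> space M. subvector X {1..n} \<omega> = zero_vector {1..n} S}"
    proof (intro Collect_cong conj_cong refl)
      fix \<omega> assume "\<omega> \<in> space M"
      then have "subvector X {1..n} \<omega> = zero_vector {1..n} (zero_set X {1..n} \<omega>)"
        using bin by (intro subvector_eq_zero_vector) auto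
      moreover have "zero_set X {1..n} \<omega> \<subseteq> {1..n}" by (auto simp: zero_set_def)
      ultimately show "zero_set X {1..n} \<omega> = S \<longleftrightarrow> subvector X {1..n} \<omega> = zero_vector {1..n} S"
        using zero_vector_inject[OF _ _ S, of "zero_set X {1..n} \<omega>"] by simp
    qed
    moreover have "zero_vector {1..n} S \<in> binary_vectors n"
      using zero_vector_binary[of "{1..n}" S] by simp
    ultimately show "M.prob {\<omega> \<in> space M. zero_set X {1..n} \<omega> = S} =
        (\<integral>\<theta>. \<theta> ^ (n - card S) * (1 - \<theta>) ^ card S \<partial>\<gamma>)"
      using \<gamma> n S cS by (simp add: de_finetti_measure_def sum_list_zero_vector)
  qed
qed

theorem proposition4:
  fixes M :: "'a measure" and X :: "nat \<Rightarrow> 'a \<Rightarrow> nat"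
  assumes "prob_space M"
    and "\<And>n. n \<ge> 1 \<Longrightarrow> X n \<in> M \<rightarrow>\<^sub>M count_space {0, 1}"
    and "sets M = sigma_sets (space M) {X n -` A \<inter> space M | n A. n \<ge> 1 \<and> A \<subseteq> {0, 1}}"
    and "exchangeable M X"
    and "non_deterministic M X"
  shows "Hoeffding_decomposable M X \<longleftrightarrow>
    (\<forall>n\<ge>2. \<forall>u\<in>{2..n}. \<forall>z\<in>{0..n - 1}.
       0 = (\<Sum>k = max 0 (z - (u - 1))..min z (n - u).
              (- 1) ^ k * real ((n - u) choose k) *
              (\<Sum>m = 0..u. (- 1) ^ m * real (u choose m) *
                 zeros_cond_prob M X (n + u - 1) n (m + z) (m + k))))"
proof -
  obtain \<gamma> where "de_finetti_measure M X \<gamma>" "\<not> measure_support \<gamma> \<subseteq> {0} \<union> {1}"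
    using assms(5) unfolding non_deterministic_def by blast
  then interpret positive_mixture M X "\<lambda>a b. \<integral>\<theta>. \<theta> ^ b * (1 - \<theta>) ^ a \<partial>\<gamma>"
    using assms(1,2) by (intro de_finetti_positive_mixture)
  show ?thesis by (rule Hoeffding_decomposable_iff_zeros_cond_prob)
qed

end
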